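(* Let $(x_i,y_i)$, $i=1,\dots,n$, be data with $x_i\in\mathbb R^d$, let $\lambda>0$, and let $$F(w)=\frac1n\sum_{i=1}^n\ell(w^\top x_i,y_i)+\lambda R(w),\qquad w\in\mathbb R^d,$$ where $\ell(z,y)$ is convex and piecewise convex quadratic as a function of $z$, and $R$ is the $\ell_1$, $\ell_\infty$, $\ell_{1,\infty}$ or Huber norm regularizer. Then $F$ satisfies the local growth condition with $\theta=1/2$: for every $\epsilon>0$ there is a constant $0<c<\infty$ such that $$\|w-w_*\|_2\le c\,(F(w)-F_* )^{1/2}\qquad\text{for all } w\in\mathcal S_\epsilon .$$ Hence ASSG (applied with $\theta=1/2$) finds a $2\epsilon$-optimal solution with probability at least $1-\delta$ with an iteration complexity of $\widetilde O\big(\frac{\log(1/\delta)}{\epsilon}\big)$, provided the stochastic subgradients are bounded in norm by a constant $G$.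
   Context: $F_*=\min_{w\in\mathbb R^d}F(w)$ (the set of minimizers is assumed nonempty), $w_*$ is the minimizer of $F$ closest to $w$, $\mathcal S_\epsilon=\{w\in\mathbb R^d:F(w)\le F_*+\epsilon\}$. A continuous function $g:\mathbb R^m\to\mathbb R$ is piecewise convex quadratic if there are finitely many polyhedra $P_1,\dots,P_r$ with $\bigcup_jP_j=\mathbb R^m$ such that the restriction of $g$ to each $P_j$ is a convex polynomial of degree at most $2$, the maximal degree being $2$. $\|w\|_{1,\infty}$ is the sum over the blocks of a fixed partition of the coordinates of the maximal absolute value within the block. The Huber function with parameter $\gamma>0$ is $\ell_\gamma(z)=\frac12z^2$ if $|z|\le\gamma$ and $\gamma(|z|-\frac12\gamma)$ otherwise; the Huber norm regularizer is $R(w)=\sum_{i=1}^d\ell_\gamma(w_i)$. ASSG refers here to the following method (ASSG-c), applied to the stochastic problem in which $\xi=i$ is uniform on $\{1,\dots,n\}$, $f(w;i)=\ell(w^\top x_i,y_i)+\lambda R(w)$, $\mathcal K=\mathbb R^d$, under the assumption $\|\partial f(w;i)\|_2\le G$. Inputs: $w_0$ with $F(w_0)-F_*\le\epsilon_0$, $\delta\in(0,1)$, $0<\epsilon<\min\{1,\epsilon_0\}$, $K=\lceil\log_2(\epsilon_0/\epsilon)\rceil$, $\tilde\delta=\delta/K$, $D_1=c\epsilon_0/\epsilon^{1-\theta}$, $t$ the smallest integer with $t\ge\max\{9,1728\log(1/\tilde\delta)\}G^2D_1^2/\epsilon_0^2$, $\eta_1=\epsilon_0/(3G^2)$. For $k=1,\dots,K$: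 $w^k_1=w_{k-1}$; for $\tau=1,\dots,t-1$, $w^k_{\tau+1}$ is the Euclidean projection of $w^k_\tau-\eta_k\partial f(w^k_\tau;\xi^k_\tau)$ onto the closed ball of radius $D_k$ centred at $w_{k-1}$, with $\xi^k_\tau$ i.i.d. copies of $\xi$; $w_k=\frac1t\sum_{\tau=1}^tw^k_\tau$, $\eta_{k+1}=\eta_k/2$, $D_{k+1}=D_k/2$. The output is $w_K$, and the iteration complexity is $Kt$. A point $w$ is $2\epsilon$-optimal if $F(w)-F_*\le2\epsilon$. $\widetilde O$ suppresses constants depending on $c,G,\epsilon_0$ and factors (poly)logarithmic in $1/\epsilon$.
   Formalization: The complexity bound is stated uniformly for δ ≤ δ_m, with δ_m < 1 arbitrary and the constant also depending on δ_m, since a bound uniform over all δ in (0,1) fails: log(1/δ) tends to 0 as δ tends to 1 while Kt ≥ 1. *)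

theory Defs
  imports "HOL-Probability.Probability"
begin

definition quadratic_function :: "('a::euclidean_space \<Rightarrow> real) \<Rightarrow> bool" where
  "quadratic_function q \<longleftrightarrow> (\<exists>A b c. linear A \<and> (\<forall>x. q x = x \<bullet> A x + b \<bullet> x + c))"

definition affine_function_on :: "'a::euclidean_space set \<Rightarrow> ('a \<Rightarrow> real) \<Rightarrow> bool" where
  "affine_function_on P g \<longleftrightarrow> (\<exists>b c. \<forall>x\<in>P. g x = b \<bullet> x + c)"

text \<open>The last clause says that the maximal degree is exactly 2. It concerns the restriction
  of \<open>g\<close> to a piece, not a chosen polynomial, because a polynomial representing \<open>g\<close> on a piece
  with empty interior is not unique.\<close>

definition piecewise_convex_quadratic :: "('a::euclidean_space \<Rightarrow> real) \<Rightarrow> bool" where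
  "piecewise_convex_quadratic g \<longleftrightarrow>
     continuous_on UNIV g \<and>
     (\<exists>\<P>. finite \<P> \<and> (\<forall>P\<in>\<P>. polyhedron P) \<and> \<Union>\<P> = UNIV \<and>
        (\<forall>P\<in>\<P>. \<exists>q. quadratic_function q \<and> convex_on UNIV q \<and> (\<forall>x\<in>P. g x = q x)) \<and>
        (\<exists>P\<in>\<P>. \<not> affine_function_on P g))"

text \<open>The \<open>\<ell>\<^sub>\<infinity>\<close> norm is the library's \<^const>\<open>infnorm\<close>.\<close>

definition l1_norm :: "real ^ 'd \<Rightarrow> real" where
  "l1_norm w = (\<Sum>i\<in>UNIV. \<bar>w $ i\<bar>)"

definition l1_inf_norm :: "'d set set \<Rightarrow> real ^ 'd \<Rightarrow> real" where
  "l1_inf_norm \<B> w = (\<Sum>B\<in>\<B>. Max ((\<lambda>i. \<bar>w $ i\<bar>) ` B))"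

definition huber :: "real \<Rightarrow> real \<Rightarrow> real" where
  "huber \<gamma> z = (if \<bar>z\<bar> \<le> \<gamma> then z\<^sup>2 / 2 else \<gamma> * (\<bar>z\<bar> - \<gamma> / 2))"

definition huber_norm :: "real \<Rightarrow> real ^ 'd \<Rightarrow> real" where
  "huber_norm \<gamma> w = (\<Sum>i\<in>UNIV. huber \<gamma> (w $ i))"

definition admissible_regularizer :: "(real ^ 'd \<Rightarrow> real) \<Rightarrow> bool" where
  "admissible_regularizer R \<longleftrightarrow>
     R = l1_norm \<or> R = infnorm \<or>
     (\<exists>\<B>. partition_on UNIV \<B> \<and> R = l1_inf_norm \<B>) \<or>
     (\<exists>\<gamma>>0. R = huber_norm \<gamma>)"

definition regularized_loss ::
  "(real \<Rightarrow> 'y \<Rightarrow> real) \<Rightarrow> (nat \<Rightarrow> real ^ 'd) \<Rightarrow> (nat \<Rightarrow> 'y) \<Rightarrow> real \<Rightarrow> (real ^ 'd \<Rightarrow> real) \<Rightarrow>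
   nat \<Rightarrow> real ^ 'd \<Rightarrow> real" where
  "regularized_loss loss x y \<mu> R i w = loss (w \<bullet> x i) (y i) + \<mu> * R w"

definition regularized_risk ::
  "(real \<Rightarrow> 'y \<Rightarrow> real) \<Rightarrow> (nat \<Rightarrow> real ^ 'd) \<Rightarrow> (nat \<Rightarrow> 'y) \<Rightarrow> real \<Rightarrow> (real ^ 'd \<Rightarrow> real) \<Rightarrow>
   nat \<Rightarrow> real ^ 'd \<Rightarrow> real" where
  "regularized_risk loss x y \<mu> R n w =
     (1 / real n) * (\<Sum>i = 1..n. loss (w \<bullet> x i) (y i)) + \<mu> * R w"

definition minimizers :: "('a \<Rightarrow> real) \<Rightarrow> 'a set" where
  "minimizers F = {v. \<forall>u. F v \<le> F u}"

text \<open>Only meaningful when the minimum is attained, i.e. when \<open>minimizers F \<noteq> {}\<close>.\<close>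

definition min_value :: "('a \<Rightarrow> real) \<Rightarrow> real" where
  "min_value F = (INF v. F v)"

definition sublevel :: "('a \<Rightarrow> real) \<Rightarrow> real \<Rightarrow> 'a set" where
  "sublevel F \<epsilon> = {w. F w \<le> min_value F + \<epsilon>}"

definition local_growth :: "('a::euclidean_space \<Rightarrow> real) \<Rightarrow> real \<Rightarrow> real \<Rightarrow> real \<Rightarrow> bool" where
  "local_growth F \<theta> c \<epsilon> \<longleftrightarrow>
     (\<forall>w\<in>sublevel F \<epsilon>.
        norm (w - closest_point (minimizers F) w) \<le> c * (F w - min_value F) powr \<theta>)"

text \<open>A growth constant for one level serves all smaller levels, so \<open>c\<close> need not vary
  as \<open>\<epsilon>\<close> tends to 0.\<close>

lemma local_growth_antimono:
  assumes "local_growth F \<theta> c \<epsilon>'" and "\<epsilon> \<le> \<epsilon>'"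
  shows "local_growth F \<theta> c \<epsilon>"
  using assms unfolding local_growth_def sublevel_def by auto

definition is_subgradient :: "('a::real_inner \<Rightarrow> real) \<Rightarrow> 'a \<Rightarrow> 'a \<Rightarrow> bool" where
  "is_subgradient f w g \<longleftrightarrow> (\<forall>u. f w + g \<bullet> (u - w) \<le> f u)"

text \<open>Here \<open>g i w\<close> is the subgradient of the \<open>i\<close>-th component that the method uses at \<open>w\<close>, and
  \<open>s \<tau>\<close> is the component sampled in step \<open>\<tau> \<ge> 1\<close>. The iterates are numbered from 0, so
  \<open>psg_iterate g \<eta> D s v j\<close> is the \<open>(j+1)\<close>-st iterate of a stage started at \<open>v\<close>, and
  a stage with \<open>t\<close> iterates uses the samples \<open>s 1, \<dots>, s (t - 1)\<close>.\<close>

primrec psg_iterate ::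
  "(nat \<Rightarrow> 'a \<Rightarrow> 'a) \<Rightarrow> real \<Rightarrow> real \<Rightarrow> (nat \<Rightarrow> nat) \<Rightarrow> 'a \<Rightarrow> nat \<Rightarrow> 'a::euclidean_space" where
  "psg_iterate g \<eta> D s v 0 = v"
| "psg_iterate g \<eta> D s v (Suc j) =
     closest_point (cball v D)
       (psg_iterate g \<eta> D s v j - \<eta> *\<^sub>R g (s (Suc j)) (psg_iterate g \<eta> D s v j))"

definition psg_average ::
  "(nat \<Rightarrow> 'a \<Rightarrow> 'a) \<Rightarrow> real \<Rightarrow> real \<Rightarrow> nat \<Rightarrow> (nat \<Rightarrow> nat) \<Rightarrow> 'a \<Rightarrow> 'a::euclidean_space" where
  "psg_average g \<eta> D t s v = (1 / real t) *\<^sub>R (\<Sum>j<t. psg_iterate g \<eta> D s v j)"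

text \<open>\<open>s k \<tau>\<close> is the sample in step \<open>\<tau>\<close> of stage \<open>k \<ge> 1\<close>; stage \<open>k\<close> has step size
  \<open>\<eta>\<^sub>1 / 2 ^ (k - 1)\<close> and radius \<open>D\<^sub>1 / 2 ^ (k - 1)\<close>.\<close>

primrec assg_stage ::
  "(nat \<Rightarrow> 'a \<Rightarrow> 'a) \<Rightarrow> real \<Rightarrow> real \<Rightarrow> nat \<Rightarrow> (nat \<Rightarrow> nat \<Rightarrow> nat) \<Rightarrow> 'a \<Rightarrow> nat \<Rightarrow>
   'a::euclidean_space" where
  "assg_stage g \<eta>\<^sub>1 D\<^sub>1 t s w\<^sub>0 0 = w\<^sub>0"
| "assg_stage g \<eta>\<^sub>1 D\<^sub>1 t s w\<^sub>0 (Suc k) =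
     psg_average g (\<eta>\<^sub>1 / 2 ^ k) (D\<^sub>1 / 2 ^ k) t (s (Suc k)) (assg_stage g \<eta>\<^sub>1 D\<^sub>1 t s w\<^sub>0 k)"

definition assg_K :: "real \<Rightarrow> real \<Rightarrow> nat" where
  "assg_K \<epsilon>\<^sub>0 \<epsilon> = nat \<lceil>log 2 (\<epsilon>\<^sub>0 / \<epsilon>)\<rceil>"

definition assg_D1 :: "real \<Rightarrow> real \<Rightarrow> real \<Rightarrow> real \<Rightarrow> real" where
  "assg_D1 \<theta> c \<epsilon>\<^sub>0 \<epsilon> = c * \<epsilon>\<^sub>0 / \<epsilon> powr (1 - \<theta>)"

definition assg_t :: "real \<Rightarrow> real \<Rightarrow> real \<Rightarrow> real \<Rightarrow> real \<Rightarrow> real \<Rightarrow> nat" where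
  "assg_t \<theta> c G \<epsilon>\<^sub>0 \<epsilon> \<delta> =
     nat \<lceil>max 9 (1728 * ln (1 / (\<delta> / real (assg_K \<epsilon>\<^sub>0 \<epsilon>)))) *
          G\<^sup>2 * (assg_D1 \<theta> c \<epsilon>\<^sub>0 \<epsilon>)\<^sup>2 / \<epsilon>\<^sub>0\<^sup>2\<rceil>"

definition assg_output ::
  "(nat \<Rightarrow> 'a \<Rightarrow> 'a) \<Rightarrow> real \<Rightarrow> real \<Rightarrow> real \<Rightarrow> real \<Rightarrow> real \<Rightarrow> real \<Rightarrow>
   (nat \<Rightarrow> nat \<Rightarrow> nat) \<Rightarrow> 'a \<Rightarrow> 'a::euclidean_space" where
  "assg_output g \<theta> c G \<epsilon>\<^sub>0 \<epsilon> \<delta> s w\<^sub>0 =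
     assg_stage g (\<epsilon>\<^sub>0 / (3 * G\<^sup>2)) (assg_D1 \<theta> c \<epsilon>\<^sub>0 \<epsilon>) (assg_t \<theta> c G \<epsilon>\<^sub>0 \<epsilon> \<delta>) s w\<^sub>0 (assg_K \<epsilon>\<^sub>0 \<epsilon>)"

definition assg_complexity :: "real \<Rightarrow> real \<Rightarrow> real \<Rightarrow> real \<Rightarrow> real \<Rightarrow> real \<Rightarrow> nat" where
  "assg_complexity \<theta> c G \<epsilon>\<^sub>0 \<epsilon> \<delta> = assg_K \<epsilon>\<^sub>0 \<epsilon> * assg_t \<theta> c G \<epsilon>\<^sub>0 \<epsilon> \<delta>"

definition iid_uniform_samples ::
  "'p measure \<Rightarrow> nat \<Rightarrow> (nat \<Rightarrow> nat \<Rightarrow> 'p \<Rightarrow> nat) \<Rightarrow> (nat \<times> nat) set \<Rightarrow> bool" where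
  "iid_uniform_samples M n \<xi> I \<longleftrightarrow>
     prob_space M \<and>
     prob_space.indep_vars M (\<lambda>_. count_space UNIV) (\<lambda>(k, \<tau>). \<xi> k \<tau>) I \<and>
     (\<forall>(k, \<tau>)\<in>I. distr M (count_space UNIV) (\<xi> k \<tau>) = measure_pmf (pmf_of_set {1..n}))"

end

theory Submission
  imports Defs
begin

text \<open>
  The growth condition rests on the fact that a convex function which is a convex quadratic on each of
  finitely many polyhedra grows at least quadratically away from its minimizers. On a single
  polyhedron this is a Hoffman-type error bound (\<open>quadratic_growth_on_polyhedron\<close>). Its
  proof projects a point onto the solution set: the direction of the difference ranges over a compact
  set that depends only on the constraints active at the projection, hence over one of finitely many
  compact sets, and on each of them the growth rate is positive. To pass from the pieces to the
  whole function one has to exclude a piece on which the infimum equals the global minimum without being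
  attained; this is the theorem of Frank and Wolfe (\<open>frank_wolfe\<close>). Convexity finally
  carries the estimate from a neighbourhood of the minimizers to arbitrary sublevel sets
  (\<open>local_growth_pieces_convex_quadratic\<close>). The regularized risk is of this kind: losses and Huber
  terms are one-dimensional piecewise quadratics composed with linear functionals, the norms are
  sums of maxima of linear functions, and the polyhedral partitions of the summands have a common
  refinement.

  For the stochastic method, the usual regret analysis of projected subgradient steps leaves a sum of
  martingale differences, which the Azuma--Hoeffding inequality controls with high probability as
  all iterates of a stage stay in a ball (\<open>stage_bound\<close>). What makes restarting with halved step size
  and radius work is the growth condition: a point that is \<open>E + \<epsilon>\<close>-optimal has an
  \<open>\<epsilon>\<close>-optimal point within distance \<open>c E / \<surd>\<epsilon>\<close> (\<open>comparator_in_ball\<close>), so the smaller ball still contains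
  a good comparison point and each stage halves \<open>E\<close>. A union bound over the logarithmically many stages
  gives the failure probability, and counting the iterates gives the complexity.
\<close>

section \<open>Convex quadratics on polyhedra\<close>

lemma convex_lower_level_set:
  assumes "convex_on UNIV f"
  shows "convex {x. f x \<le> (a::real)}"
  unfolding convex_alt
proof (clarify)
  fix x y and t :: real
  assume *: "f x \<le> a" "f y \<le> a" "0 \<le> t" "t \<le> 1"
  have "f ((1 - t) *\<^sub>R x + t *\<^sub>R y) \<le> (1 - t) * f x + t * f y"
    using convex_onD[OF assms] * by blast
  also have "\<dots> \<le> (1 - t) * a + t * a" using * by (intro add_mono mult_left_mono) auto
  finally show "f ((1 - t) *\<^sub>R x + t *\<^sub>R y) \<le> a" by (simp add: algebra_simps)
qed

lemma polyhedron_iff_inequalities: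
  fixes P :: "'a::euclidean_space set"
  shows "polyhedron P \<longleftrightarrow> (\<exists>I. finite I \<and> P = {x. \<forall>i\<in>I. fst i \<bullet> x \<le> snd i})"
proof
  assume "polyhedron P"
  then obtain H where H: "finite H" "P = \<Inter>H"
    and *: "\<forall>h\<in>H. \<exists>a b. a \<noteq> 0 \<and> h = {x. a \<bullet> x \<le> b}"
    unfolding polyhedron_def by blast
  from * obtain a b where ab: "\<forall>h\<in>H. h = {x. a h \<bullet> x \<le> b h}" by metis
  have "P = {x. \<forall>i\<in>(\<lambda>h. (a h, b h)) ` H. fst i \<bullet> x \<le> snd i}"
    using H ab by auto
  with H show "\<exists>I. finite I \<and> P = {x. \<forall>i\<in>I. fst i \<bullet> x \<le> snd i}" by blast
next
  assume "\<exists>I. finite I \<and> P = {x. \<forall>i\<in>I. fst i \<bullet> x \<le> snd i}"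
  then obtain I where I: "finite I" "P = {x. \<forall>i\<in>I. fst i \<bullet> x \<le> snd i}" by blast
  have "P = \<Inter>((\<lambda>i. {x. fst i \<bullet> x \<le> snd i}) ` I)" using I by auto
  moreover have "polyhedron (\<Inter>((\<lambda>i. {x. fst i \<bullet> x \<le> snd i}) ` I))"
    using I by (intro polyhedron_Inter) (auto intro: polyhedron_halfspace_le)
  ultimately show "polyhedron P" by simp
qed

lemma quadratic_expand:
  fixes A :: "'a::real_inner \<Rightarrow> 'a"
  assumes "linear A"
  shows "(p + d) \<bullet> A (p + d) = p \<bullet> A p + (p \<bullet> A d + d \<bullet> A p) + d \<bullet> A d"
  using assms by (simp add: linear_add inner_add)

lemma convex_quadratic_psd:
  fixes A :: "'a::real_inner \<Rightarrow> 'a"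
  assumes A: "linear A" and c: "convex_on UNIV (\<lambda>x. x \<bullet> A x + b \<bullet> x + c)"
  shows "0 \<le> d \<bullet> A d"
proof -
  have "(0::'a) \<bullet> A 0 + b \<bullet> 0 + c
    \<le> (1/2) * (d \<bullet> A d + b \<bullet> d + c) + (1/2) * ((-d) \<bullet> A (-d) + b \<bullet> (-d) + c)"
    using convex_onD[OF c, of "1/2" d "-d"] by simp
  then show ?thesis using A by (simp add: linear_neg field_simps)
qed

text \<open>A positive semidefinite form takes its minimum 0 at an isotropic vector, so its derivative
  there vanishes.\<close>

lemma psd_isotropic_cross_zero:
  fixes A :: "'a::real_inner \<Rightarrow> 'a"
  assumes A: "linear A" and psd: "\<And>d. 0 \<le> d \<bullet> A d" and e: "e \<bullet> A e = 0"
  shows "p \<bullet> A e + e \<bullet> A p = 0"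
proof (rule ccontr)
  define X where "X = p \<bullet> A e + e \<bullet> A p"
  assume "p \<bullet> A e + e \<bullet> A p \<noteq> 0"
  then have X: "X \<noteq> 0" by (simp add: X_def)
  define t where "t = - (p \<bullet> A p + 1) / X"
  have "(p + t *\<^sub>R e) \<bullet> A (p + t *\<^sub>R e) = p \<bullet> A p + t * X"
    using A e by (simp add: linear_add linear_scale inner_add X_def algebra_simps)
  also have "\<dots> = -1" using X by (simp add: t_def)
  finally show False using psd[of "p + t *\<^sub>R e"] by simp
qed

text \<open>The minimum cannot escape to infinity. If no minimum existed, the least-norm minimizers \<open>X n\<close> over
  growing balls would lie on the bounding spheres, and a limit \<open>d\<close> of their directions would be a
  recession direction of the polyhedron along which the quadratic is constant. Far out, every
  constraint that is not constant along \<open>d\<close> is slack, so \<open>X n - d\<close> is again feasible, has the same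
  value and a smaller norm.\<close>

lemma frank_wolfe:
  fixes P :: "'a::euclidean_space set"
  assumes P: "polyhedron P" "P \<noteq> {}"
    and q: "quadratic_function q" "convex_on UNIV q"
    and bdd: "\<And>x. x \<in> P \<Longrightarrow> m \<le> q x"
  shows "\<exists>p\<in>P. \<forall>x\<in>P. q p \<le> q x"
proof (rule ccontr)
  assume nomin: "\<not> (\<exists>p\<in>P. \<forall>x\<in>P. q p \<le> q x)"
  obtain A b c where A: "linear A" and qx: "\<And>x. q x = x \<bullet> A x + b \<bullet> x + c"
    using q(1) unfolding quadratic_function_def by blast
  have q_eq: "q = (\<lambda>x. x \<bullet> A x + b \<bullet> x + c)" using qx by blast
  have psd: "0 \<le> d \<bullet> A d" for d
    using convex_quadratic_psd[OF A] q(2) unfolding q_eq by blast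
  have contA: "continuous_on S A" for S using A by (rule linear_continuous_on[OF linear_conv_bounded_linear[THEN iffD1]])
  have contq: "continuous_on S q" for S
    unfolding q_eq by (intro continuous_intros contA)
  obtain I where I: "finite I" "P = {x. \<forall>i\<in>I. fst i \<bullet> x \<le> snd i}"
    using P(1) polyhedron_iff_inequalities by blast
  obtain x0 where x0: "x0 \<in> P" using P by blast
  define S where "S k = P \<inter> cball 0 k" for k :: real
  define M where "M k = {x\<in>S k. \<forall>y\<in>S k. q x \<le> q y}" for k
  have compS: "compact (S k)" for k
    unfolding S_def using P(1) by (simp add: polyhedron_imp_closed closed_Int_compact)
  have exX: "\<exists>x\<in>M k. \<forall>y\<in>M k. norm x \<le> norm y" if "norm x0 \<le> k" for k
  proof -
    have "S k \<noteq> {}" using x0 that by (auto simp: S_def)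
    then obtain x1 where x1: "x1 \<in> S k" "\<forall>y\<in>S k. q x1 \<le> q y"
      using continuous_attains_inf[OF compS _ contq] by blast
    have "M k = {x \<in> S k. q x \<le> q x1}"
      using x1 unfolding M_def by force
    moreover have "closed {x \<in> S k. q x \<le> q x1}"
      by (rule continuous_on_closed_Collect_le) (auto intro: contq compact_imp_closed compS)
    ultimately have "compact (S k \<inter> M k)"
      using compact_Int_closed[OF compS] by simp
    moreover have "S k \<inter> M k = M k" by (auto simp: M_def)
    ultimately have "compact (M k)" by simp
    moreover have "M k \<noteq> {}" using x1 by (auto simp: M_def)
    ultimately show ?thesis
      using continuous_attains_inf[of "M k" norm] by (auto intro: continuous_intros)
  qed
  define N where "N n = norm x0 + 1 + real n" for n
  have "\<forall>n. \<exists>x. x \<in> M (N n) \<and> (\<forall>y\<in>M (N n). norm x \<le> norm y)"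
    using exX by (metis N_def add_increasing2 le_add_same_cancel1 of_nat_0_le_iff zero_le_one)
  then obtain X where X: "\<And>n. X n \<in> M (N n)" and Xmin: "\<And>n y. y \<in> M (N n) \<Longrightarrow> norm (X n) \<le> norm y"
    by metis
  have Npos: "N n > 0" for n unfolding N_def by (smt (verit) norm_ge_zero of_nat_0_le_iff)
  have XP: "X n \<in> P" for n using X[of n] by (auto simp: M_def S_def)
  \<comment> \<open>A minimizer over the ball that is interior to the ball would be a global one.\<close>
  have normX: "norm (X n) = N n" for n
  proof (rule ccontr)
    assume "norm (X n) \<noteq> N n"
    then have lt: "norm (X n) < N n" using X[of n] by (auto simp: M_def S_def)
    have "q (X n) \<le> q y" if y: "y \<in> P" for y
    proof -
      define t where "t = min 1 ((N n - norm (X n)) / (norm (y - X n) + 1))"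
      have t: "0 < t" "t \<le> 1" using lt by (auto simp: t_def add_nonneg_pos)
      define z where "z = X n + t *\<^sub>R (y - X n)"
      have zc: "z = (1 - t) *\<^sub>R X n + t *\<^sub>R y" by (simp add: z_def algebra_simps)
      have "z \<in> P" unfolding zc using polyhedron_imp_convex[OF P(1)] XP y t
        by (intro convexD) auto
      moreover have "norm z \<le> N n"
      proof -
        have "t * norm (y - X n) \<le> t * (norm (y - X n) + 1)" using t by simp
        also have "\<dots> \<le> (N n - norm (X n)) / (norm (y - X n) + 1) * (norm (y - X n) + 1)"
          by (intro mult_right_mono) (auto simp: t_def)
        also have "\<dots> = N n - norm (X n)"
          by (smt (verit) norm_ge_zero nonzero_eq_divide_eq)
        finally show ?thesis
          unfolding z_def using norm_triangle_ineq[of "X n" "t *\<^sub>R (y - X n)"] t by simp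
      qed
      ultimately have "q (X n) \<le> q z" using X[of n] by (auto simp: M_def S_def)
      also have "\<dots> \<le> (1 - t) * q (X n) + t * q y"
        unfolding zc using convex_onD[OF q(2)] t by auto
      finally have "t * q (X n) \<le> t * q y" by (simp add: algebra_simps)
      then show ?thesis using t by simp
    qed
    then show False using nomin XP by blast
  qed
  define D where "D n = X n /\<^sub>R N n" for n
  have XD: "X n = N n *\<^sub>R D n" for n using Npos[of n] by (simp add: D_def)
  have "D n \<in> sphere 0 1" for n using normX[of n] Npos[of n] by (simp add: D_def)
  then obtain d r where d: "d \<in> sphere 0 1" and r: "strict_mono r" and lim: "(D \<circ> r) \<longlonglongrightarrow> d"
    using compact_sphere[of 0 1] unfolding compact_def by metis
  have Dlim: "(\<lambda>n. D (r n)) \<longlonglongrightarrow> d" using lim by (simp add: o_def)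
  have Nlim0: "filterlim N at_top sequentially"
    unfolding N_def
    by (intro filterlim_tendsto_add_at_top[OF tendsto_const] filterlim_real_sequentially)
  have Nlim: "filterlim (\<lambda>n. N (r n)) at_top sequentially"
    using filterlim_compose[OF Nlim0 filterlim_subseq[OF r]] .
  have inv0: "(\<lambda>n. C / N (r n)) \<longlonglongrightarrow> 0" for C
    using Nlim by (rule real_tendsto_divide_at_top[OF tendsto_const])
  \<comment> \<open>\<open>d\<close> is a recession direction along which the quadratic part vanishes.\<close>
  have recession: "fst i \<bullet> d \<le> 0" if "i \<in> I" for i
  proof -
    have "fst i \<bullet> D (r n) \<le> snd i / N (r n)" for n
      using XP[of "r n"] that I(2) Npos[of "r n"] unfolding XD by (simp add: field_simps)
    then show ?thesis
      using LIMSEQ_le[OF tendsto_inner[OF tendsto_const Dlim] inv0] by blast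
  qed
  have Alim: "(\<lambda>n. A (D (r n))) \<longlonglongrightarrow> A d"
    using A Dlim by (metis bounded_linear.tendsto linear_conv_bounded_linear)
  have qle: "(N (r n))\<^sup>2 * (D (r n) \<bullet> A (D (r n))) + N (r n) * (b \<bullet> D (r n)) \<le> q x0 - c" for n
  proof -
    have "x0 \<in> S (N (r n))" using x0 by (auto simp: S_def N_def)
    then have "q (X (r n)) \<le> q x0" using X[of "r n"] by (auto simp: M_def)
    then show ?thesis
      unfolding qx[of "X (r n)"] unfolding XD using A
      by (simp add: linear_scale power2_eq_square algebra_simps)
  qed
  have "d \<bullet> A d \<le> 0 - 0"
  proof (rule LIMSEQ_le)
    show "(\<lambda>n. D (r n) \<bullet> A (D (r n))) \<longlonglongrightarrow> d \<bullet> A d"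
      by (intro tendsto_inner Dlim Alim)
    have "(\<lambda>n. (q x0 - c) / N (r n) * (1 / N (r n)) - (b \<bullet> D (r n)) * (1 / N (r n))) \<longlonglongrightarrow> 0 * 0 - (b \<bullet> d) * 0"
      by (intro tendsto_diff tendsto_mult inv0 tendsto_inner tendsto_const Dlim)
    then show "(\<lambda>n. (q x0 - c) / N (r n) * (1 / N (r n)) - (b \<bullet> D (r n)) * (1 / N (r n))) \<longlonglongrightarrow> 0 - 0" by simp
    have "D (r n) \<bullet> A (D (r n)) \<le> (q x0 - c) / N (r n) * (1 / N (r n)) - (b \<bullet> D (r n)) * (1 / N (r n))" for n
    proof -
      have "D (r n) \<bullet> A (D (r n)) \<le> ((q x0 - c) - N (r n) * (b \<bullet> D (r n))) / (N (r n))\<^sup>2"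
        using qle[of n] Npos[of "r n"] by (simp add: pos_le_divide_eq mult.commute)
      also have "\<dots> = (q x0 - c) / N (r n) * (1 / N (r n)) - (b \<bullet> D (r n)) * (1 / N (r n))"
        using Npos[of "r n"] by (simp add: field_simps power2_eq_square)
      finally show ?thesis .
    qed
    then show "\<exists>N'. \<forall>n\<ge>N'. D (r n) \<bullet> A (D (r n)) \<le> (q x0 - c) / N (r n) * (1 / N (r n)) - (b \<bullet> D (r n)) * (1 / N (r n))"
      by blast
  qed
  then have Ad: "d \<bullet> A d = 0" using psd[of d] by simp
  note cross = psd_isotropic_cross_zero[OF A psd Ad]
  have qline: "q (y + s *\<^sub>R d) = q y + s * (b \<bullet> d)" for y s
  proof -
    have "(y + s *\<^sub>R d) \<bullet> A (y + s *\<^sub>R d) = y \<bullet> A y + s * (y \<bullet> A d + d \<bullet> A y) + s\<^sup>2 * (d \<bullet> A d)"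
      using A by (simp add: linear_add linear_scale inner_add power2_eq_square algebra_simps)
    then have "(y + s *\<^sub>R d) \<bullet> A (y + s *\<^sub>R d) = y \<bullet> A y" using cross[of y] Ad by simp
    then show ?thesis unfolding qx by (simp add: inner_add_right)
  qed
  have bd_le: "b \<bullet> d \<le> 0"
  proof -
    have "b \<bullet> D (r n) \<le> (q x0 - c) / N (r n)" for n
    proof -
      have "0 \<le> (N (r n))\<^sup>2 * (D (r n) \<bullet> A (D (r n)))" using psd by simp
      with qle[of n] have "N (r n) * (b \<bullet> D (r n)) \<le> q x0 - c" by linarith
      then show ?thesis using Npos[of "r n"] by (simp add: field_simps)
    qed
    then show ?thesis
      using LIMSEQ_le[OF tendsto_inner[OF tendsto_const Dlim] inv0] by blast
  qed
  \<comment> \<open>A negative slope along \<open>d\<close> would contradict boundedness from below.\<close>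
  have bd: "b \<bullet> d = 0"
  proof (rule ccontr)
    assume "b \<bullet> d \<noteq> 0"
    with bd_le have neg: "b \<bullet> d < 0" by simp
    define s where "s = (q x0 - m + 1) / - (b \<bullet> d)"
    have s: "s \<ge> 0" unfolding s_def using neg bdd[OF x0] by (intro divide_nonneg_pos) auto
    have "x0 + s *\<^sub>R d \<in> P"
    proof -
      have "fst i \<bullet> x0 + s * (fst i \<bullet> d) \<le> snd i" if "i \<in> I" for i
        using recession[OF that] x0 that I(2) s mult_nonneg_nonpos[of s "fst i \<bullet> d"] by fastforce
      then show ?thesis using I(2) by (simp add: inner_add)
    qed
    then have "m \<le> q x0 + s * (b \<bullet> d)" using bdd qline by metis
    moreover have "s * (b \<bullet> d) = - (q x0 - m + 1)" using neg by (simp add: s_def)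
    ultimately show False by simp
  qed
  have dd: "d \<bullet> d = 1" using d by (simp add: norm_eq_1)
  have ev1: "\<forall>\<^sub>F n in sequentially. 1 < 2 * N (r n) * (D (r n) \<bullet> d)"
  proof -
    have "(\<lambda>n. D (r n) \<bullet> d) \<longlonglongrightarrow> 1" using tendsto_inner[OF Dlim tendsto_const[of d]] dd by simp
    then have "filterlim (\<lambda>n. (D (r n) \<bullet> d) * N (r n)) at_top sequentially"
      by (rule filterlim_tendsto_pos_mult_at_top[OF _ _ Nlim]) simp
    then have "\<forall>\<^sub>F n in sequentially. 1 < (D (r n) \<bullet> d) * N (r n)"
      by (simp add: filterlim_at_top_dense)
    then show ?thesis by eventually_elim (simp add: algebra_simps)
  qed
  have ev2: "\<forall>\<^sub>F n in sequentially. \<forall>i\<in>I. fst i \<bullet> X (r n) - fst i \<bullet> d \<le> snd i"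
    unfolding eventually_ball_finite_distrib[OF I(1)]
  proof
    fix i assume i: "i \<in> I"
    show "\<forall>\<^sub>F n in sequentially. fst i \<bullet> X (r n) - fst i \<bullet> d \<le> snd i"
    proof (cases "fst i \<bullet> d = 0")
      case True
      then show ?thesis using XP i I(2) by simp
    next
      case False
      with recession[OF i] have neg: "- (fst i \<bullet> d) > 0" by simp
      have "(\<lambda>n. - (fst i \<bullet> D (r n))) \<longlonglongrightarrow> - (fst i \<bullet> d)"
        by (intro tendsto_intros Dlim)
      then have "filterlim (\<lambda>n. (- (fst i \<bullet> D (r n))) * N (r n)) at_top sequentially"
        by (rule filterlim_tendsto_pos_mult_at_top[OF _ neg Nlim])
      then have "\<forall>\<^sub>F n in sequentially. - snd i - fst i \<bullet> d \<le> (- (fst i \<bullet> D (r n))) * N (r n)"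
        by (simp add: filterlim_at_top)
      then show ?thesis by eventually_elim (simp add: XD algebra_simps)
    qed
  qed
  obtain n where n: "1 < 2 * N (r n) * (D (r n) \<bullet> d)" "\<forall>i\<in>I. fst i \<bullet> X (r n) - fst i \<bullet> d \<le> snd i"
    using eventually_happens[OF eventually_conj[OF ev1 ev2]] by auto
  \<comment> \<open>the competing minimizer of smaller norm\<close>
  define z where "z = X (r n) - d"
  have zP: "z \<in> P" using n(2) I(2) by (simp add: z_def inner_diff_right)
  have "(norm z)\<^sup>2 = (norm (X (r n)))\<^sup>2 - 2 * N (r n) * (D (r n) \<bullet> d) + 1"
    using dd unfolding z_def power2_norm_eq_inner
    by (simp add: XD inner_diff inner_commute algebra_simps)
  then have "(norm z)\<^sup>2 < (norm (X (r n)))\<^sup>2" using n(1) by simp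
  then have zlt: "norm z < norm (X (r n))" by (simp add: power2_less_imp_less)
  have "q z = q (X (r n))" using qline[of "X (r n)" "-1"] bd by (simp add: z_def)
  moreover have "z \<in> S (N (r n))" using zP zlt normX[of "r n"] by (simp add: S_def)
  ultimately have "z \<in> M (N (r n))" using X[of "r n"] by (auto simp: M_def)
  then show False using Xmin zlt by fastforce
qed

text \<open>A Hoffman-type error bound. Let \<open>p\<close> be the projection of a feasible point \<open>w\<close> onto the solution set
  and \<open>\<tau>\<close> the set of constraints active at \<open>p\<close>. The direction of \<open>w - p\<close> is a unit vector that points
  into the polyhedron and is normal to the solution set, and both conditions depend on \<open>p\<close> only
  through \<open>\<tau>\<close>: these vectors form a compact set \<open>C \<tau>\<close>. On it the growth rate, first-order part \<open>G\<close>
  plus second-order part \<open>Q\<close>, is positive, since a direction without growth is a direction of the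
  solution set and cannot be normal to it. So the rate is bounded below on each \<open>C \<tau>\<close>, and there
  are only finitely many \<open>\<tau>\<close>. The minimum of the distance and its square reflects that either
  \<open>G\<close> or \<open>Q\<close> may be responsible for the growth.\<close>

lemma quadratic_growth_on_polyhedron:
  fixes P :: "'a::euclidean_space set"
  assumes P: "polyhedron P"
    and q: "quadratic_function q" "convex_on UNIV q"
    and p0: "p0 \<in> P" and p0min: "\<And>x. x \<in> P \<Longrightarrow> q p0 \<le> q x"
  shows "\<exists>\<kappa>>0. \<forall>w\<in>P. \<exists>p\<in>P. q p = q p0 \<and>
           \<kappa> * min (norm (w - p)) ((norm (w - p))\<^sup>2) \<le> q w - q p0"
proof -
  obtain A b c where A: "linear A" and qx: "\<And>x. q x = x \<bullet> A x + b \<bullet> x + c"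
    using q(1) unfolding quadratic_function_def by blast
  have q_eq: "q = (\<lambda>x. x \<bullet> A x + b \<bullet> x + c)" using qx by blast
  have psd: "0 \<le> d \<bullet> A d" for d
    using convex_quadratic_psd[OF A] q(2) unfolding q_eq by blast
  have contA: "continuous_on S A" for S using A by (rule linear_continuous_on[OF linear_conv_bounded_linear[THEN iffD1]])
  have contq: "continuous_on S q" for S
    unfolding q_eq by (intro continuous_intros contA)
  obtain I where I: "finite I" "P = {x. \<forall>i\<in>I. fst i \<bullet> x \<le> snd i}"
    using P(1) polyhedron_iff_inequalities by blast
  note convP = polyhedron_imp_convex[OF P]
  \<comment> \<open>first- and second-order parts of \<open>q\<close> at the minimizer\<close>
  define G where "G d = p0 \<bullet> A d + d \<bullet> A p0 + b \<bullet> d" for d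
  define Q where "Q d = d \<bullet> A d" for d
  have Gadd: "G (d + e) = G d + G e" and Gscale: "G (s *\<^sub>R d) = s * G d" for d e s
    using A by (simp_all add: G_def linear_add linear_scale inner_add algebra_simps)
  have Gdiff: "G (d - e) = G d - G e" for d e
    using Gadd[of d "- e"] Gscale[of "-1" e] by simp
  have Qscale: "Q (s *\<^sub>R d) = s\<^sup>2 * Q d" for d s
    using A by (simp add: Q_def linear_scale power2_eq_square)
  have Qpos: "Q d \<ge> 0" for d using psd by (simp add: Q_def)
  have Qnull: "Q (v + e) = Q v" if "Q e = 0" for v e
    using psd_isotropic_cross_zero[OF A psd, of e v] that quadratic_expand[OF A, of v e]
    by (simp add: Q_def)
  have expand: "q (p0 + v) = q p0 + G v + Q v" for v
    unfolding qx G_def Q_def using quadratic_expand[OF A, of p0 v] by (simp add: inner_add)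
  have contG: "continuous_on S G" and contQ: "continuous_on S Q" for S
    unfolding G_def Q_def by (intro continuous_intros contA)+
  have Gfeas: "G (x - p0) \<ge> 0" if x: "x \<in> P" for x
  proof (rule ccontr)
    assume "\<not> G (x - p0) \<ge> 0"
    then have neg: "G (x - p0) < 0" by simp
    define t where "t = min 1 (- G (x - p0) / (2 * (Q (x - p0) + 1)))"
    have "0 < - G (x - p0) / (2 * (Q (x - p0) + 1))"
      using neg Qpos[of "x - p0"] by (intro divide_pos_pos) auto
    then have t: "0 < t" "t \<le> 1" unfolding t_def by linarith+
    have "p0 + t *\<^sub>R (x - p0) \<in> P"
      using convexD[OF convP p0 x, of "1 - t" t] t by (simp add: algebra_simps)
    then have "0 \<le> t * G (x - p0) + t\<^sup>2 * Q (x - p0)"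
      using p0min expand Gscale Qscale by (smt (verit))
    then have "0 \<le> t * (G (x - p0) + t * Q (x - p0))" by (simp add: power2_eq_square algebra_simps)
    then have "0 \<le> G (x - p0) + t * Q (x - p0)" using t by (simp add: zero_le_mult_iff)
    moreover have "t * Q (x - p0) \<le> t * (Q (x - p0) + 1)" using t by simp
    moreover have "t * (Q (x - p0) + 1) \<le> - G (x - p0) / (2 * (Q (x - p0) + 1)) * (Q (x - p0) + 1)"
      using Qpos[of "x - p0"] by (intro mult_right_mono) (auto simp: t_def)
    moreover have "- G (x - p0) / (2 * (Q (x - p0) + 1)) * (Q (x - p0) + 1) = - G (x - p0) / 2"
      using Qpos[of "x - p0"] by (simp add: field_simps)
    ultimately show False using neg by linarith
  qed
  \<comment> \<open>Both parts vanish on differences to solutions, and \<open>Q\<close> ignores such shifts, so the expansion at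
     \<open>p0\<close> serves at every solution.\<close>
  define \<Omega> where "\<Omega> = {p\<in>P. q p = q p0}"
  have \<Omega>0: "G (p - p0) = 0" "Q (p - p0) = 0" if "p \<in> \<Omega>" for p
    using that Gfeas[of p] Qpos[of "p - p0"] expand[of "p - p0"] by (auto simp: \<Omega>_def)
  have cl\<Omega>: "closed \<Omega>"
  proof -
    have "closed {p \<in> P. q p = q p0}"
      using polyhedron_imp_closed[OF P]
      by (intro continuous_closed_preimage_constant contq)
    then show ?thesis by (simp add: \<Omega>_def)
  qed
  have conv\<Omega>: "convex \<Omega>"
  proof -
    have "\<Omega> = P \<inter> {x. q x \<le> q p0}" using p0min by (force simp: \<Omega>_def)
    then show ?thesis using convex_Int[OF convP convex_lower_level_set[OF q(2), of "q p0"]] by simp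
  qed
  have ne\<Omega>: "\<Omega> \<noteq> {}" using p0 by (auto simp: \<Omega>_def)
  \<comment> \<open>\<open>E \<tau>\<close>: directions in which the solution set extends from a point with active set \<open>\<tau>\<close>;
     \<open>C \<tau>\<close>: unit directions pointing into the polyhedron and normal to the solution set there\<close>
  define E where "E \<tau> = {e. (\<forall>i\<in>\<tau>. fst i \<bullet> e \<le> 0) \<and> G e = 0 \<and> Q e = 0}" for \<tau> :: "('a \<times> real) set"
  define C where "C \<tau> = {d. norm d = 1 \<and> (\<forall>i\<in>\<tau>. fst i \<bullet> d \<le> 0) \<and> 0 \<le> G d \<and> (\<forall>e\<in>E \<tau>. d \<bullet> e \<le> 0)}" for \<tau> :: "('a \<times> real) set"
  \<comment> \<open>Vanishing growth puts \<open>d\<close> into \<open>E \<tau>\<close>, and then normality gives \<open>d \<bullet> d \<le> 0\<close>.\<close>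
  have C_gap: "\<exists>\<kappa>>0. \<forall>d\<in>C \<tau>. \<kappa> \<le> G d + Q d" for \<tau>
  proof (cases "C \<tau> = {}")
    case True
    then show ?thesis by (intro exI[of _ 1]) auto
  next
    case False
    have "C \<tau> = sphere 0 1 \<inter> ((\<Inter>i\<in>\<tau>. {d. fst i \<bullet> d \<le> 0}) \<inter> {d. 0 \<le> G d} \<inter> (\<Inter>e\<in>E \<tau>. {d. d \<bullet> e \<le> 0}))"
      by (auto simp: C_def)
    moreover have "closed {d. 0 \<le> G d}"
      by (intro closed_Collect_le continuous_intros contG)
    moreover have "closed {d. d \<bullet> e \<le> 0}" for e :: 'a
      by (intro closed_Collect_le continuous_intros)
    ultimately have "compact (C \<tau>)"
      by (auto intro!: compact_Int_closed closed_Int closed_INT closed_halfspace_le)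
    then obtain d where d: "d \<in> C \<tau>" "\<forall>y\<in>C \<tau>. G d + Q d \<le> G y + Q y"
      using continuous_attains_inf[OF _ False, of "\<lambda>d. G d + Q d"] contG contQ
      by (metis continuous_on_add)
    have "G d + Q d \<noteq> 0"
    proof
      assume "G d + Q d = 0"
      then have "d \<in> E \<tau>" using d(1) Qpos[of d] by (auto simp: C_def E_def)
      then have "d \<bullet> d \<le> 0" using d(1) by (auto simp: C_def)
      then have "d = 0" by (metis inner_gt_zero_iff not_less)
      then show False using d(1) by (simp add: C_def)
    qed
    then have "G d + Q d > 0" using d(1) Qpos[of d] by (auto simp: C_def)
    with d(2) show ?thesis by blast
  qed
  then obtain K where K: "\<And>\<tau>. K \<tau> > 0" "\<And>\<tau> d. d \<in> C \<tau> \<Longrightarrow> K \<tau> \<le> G d + Q d"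
    by metis
  define \<kappa> where "\<kappa> = Min (K ` Pow I)"
  have fin: "finite (K ` Pow I)" "K ` Pow I \<noteq> {}" using I(1) by auto
  have \<kappa>: "\<kappa> > 0" using fin K(1) by (auto simp: \<kappa>_def)
  have "\<exists>p\<in>P. q p = q p0 \<and> \<kappa> * min (norm (w - p)) ((norm (w - p))\<^sup>2) \<le> q w - q p0" if w: "w \<in> P" for w
  proof -
    define p where "p = closest_point \<Omega> w"
    have p: "p \<in> \<Omega>" unfolding p_def by (rule closest_point_in_set[OF cl\<Omega> ne\<Omega>])
    then have pP: "p \<in> P" "q p = q p0" by (auto simp: \<Omega>_def)
    define d where "d = w - p"
    have gap: "q w - q p0 = G d + Q d"
    proof -
      have eq: "w - p0 = d + (p - p0)" by (simp add: d_def)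
      have "G (w - p0) = G d" by (simp only: eq Gadd \<Omega>0(1)[OF p] add_0_right)
      moreover have "Q (w - p0) = Q d" by (simp only: eq Qnull[OF \<Omega>0(2)[OF p]])
      ultimately show ?thesis using expand[of "w - p0"] by simp
    qed
    have Gd: "G d \<ge> 0"
    proof -
      have "G d = G ((w - p0) - (p - p0))" by (simp add: d_def)
      also have "\<dots> = G (w - p0)"
        unfolding Gdiff[of "w - p0" "p - p0"] \<Omega>0(1)[OF p] by (rule diff_zero)
      finally show ?thesis using Gfeas[OF w] by simp
    qed
    show ?thesis
    proof (cases "d = 0")
      case True
      then show ?thesis using pP gap Gd Qpos[of d] d_def by (intro bexI[of _ p]) auto
    next
      case False
      define \<tau> where "\<tau> = {i\<in>I. fst i \<bullet> p = snd i}"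
      define u where "u = d /\<^sub>R norm d"
      have du: "d = norm d *\<^sub>R u" using False by (simp add: u_def)
      have nd: "norm d > 0" using False by simp
      have "u \<in> C \<tau>"
        unfolding C_def
      proof (intro CollectI conjI ballI)
        show "norm u = 1" using False by (simp add: u_def)
        show "0 \<le> G u" using Gd Gscale nd by (simp add: u_def)
        fix i assume i: "i \<in> \<tau>"
        then have "fst i \<bullet> d \<le> 0" using w I(2) by (auto simp: \<tau>_def d_def inner_diff_right)
        then show "fst i \<bullet> u \<le> 0" using nd by (simp add: u_def mult_nonneg_nonpos)
      next
        fix e assume e: "e \<in> E \<tau>"
        \<comment> \<open>A short step from \<open>p\<close> along \<open>e\<close> stays in the solution set: active constraints are
           respected by the choice of \<open>e\<close>, the others have slack.\<close>
        have "\<forall>i\<in>I. \<exists>s>0. \<forall>t. 0 \<le> t \<and> t \<le> s \<longrightarrow> fst i \<bullet> (p + t *\<^sub>R e) \<le> snd i"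
        proof
          fix i assume i: "i \<in> I"
          show "\<exists>s>0. \<forall>t. 0 \<le> t \<and> t \<le> s \<longrightarrow> fst i \<bullet> (p + t *\<^sub>R e) \<le> snd i"
          proof (cases "i \<in> \<tau>")
            case True
            then have "fst i \<bullet> e \<le> 0" "fst i \<bullet> p = snd i" using e by (auto simp: E_def \<tau>_def)
            then have "fst i \<bullet> (p + t *\<^sub>R e) \<le> snd i" if "0 \<le> t" for t
              using mult_nonneg_nonpos[OF that, of "fst i \<bullet> e"] by (simp add: inner_add)
            then show ?thesis by (intro exI[of _ 1]) auto
          next
            case False
            then have slack: "snd i - fst i \<bullet> p > 0" using i pP(1) I(2) by (force simp: \<tau>_def)
            define s where "s = (snd i - fst i \<bullet> p) / (\<bar>fst i \<bullet> e\<bar> + 1)"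
            have s: "s > 0" using slack by (simp add: s_def add_nonneg_pos)
            have "fst i \<bullet> (p + t *\<^sub>R e) \<le> snd i" if t: "0 \<le> t" "t \<le> s" for t
            proof -
              have "t * (fst i \<bullet> e) \<le> t * (\<bar>fst i \<bullet> e\<bar> + 1)" using t by (intro mult_left_mono) auto
              also have "\<dots> \<le> s * (\<bar>fst i \<bullet> e\<bar> + 1)" using t by (intro mult_right_mono) auto
              also have "\<dots> = snd i - fst i \<bullet> p" by (simp add: s_def add_nonneg_eq_0_iff)
              finally show ?thesis by (simp add: inner_add)
            qed
            with s show ?thesis by blast
          qed
        qed
        then obtain s where s: "\<And>i. i \<in> I \<Longrightarrow> s i > 0"
          "\<And>i t. i \<in> I \<Longrightarrow> 0 \<le> t \<Longrightarrow> t \<le> s i \<Longrightarrow> fst i \<bullet> (p + t *\<^sub>R e) \<le> snd i"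
          by metis
        define t where "t = Min (insert 1 (s ` I))"
        have t: "t > 0" "\<And>i. i \<in> I \<Longrightarrow> t \<le> s i" using I(1) s(1) by (auto simp: t_def)
        have "p + t *\<^sub>R e \<in> P" using s(2) t I(2) by auto
        moreover have "q (p + t *\<^sub>R e) = q p0"
        proof -
          have "p + t *\<^sub>R e = p0 + ((p - p0) + t *\<^sub>R e)" by simp
          then have "q (p + t *\<^sub>R e) = q p0 + G ((p - p0) + t *\<^sub>R e) + Q ((p - p0) + t *\<^sub>R e)"
            using expand by metis
          moreover have "G ((p - p0) + t *\<^sub>R e) = 0"
            using e by (simp only: Gadd Gscale \<Omega>0(1)[OF p]) (simp add: E_def)
          moreover have "Q (t *\<^sub>R e) = 0" using e by (simp only: Qscale) (simp add: E_def)
          then have "Q ((p - p0) + t *\<^sub>R e) = 0" by (simp only: Qnull \<Omega>0(2)[OF p])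
          ultimately show ?thesis by simp
        qed
        ultimately have "p + t *\<^sub>R e \<in> \<Omega>" by (simp add: \<Omega>_def)
        then have "(w - p) \<bullet> (p + t *\<^sub>R e - p) \<le> 0"
          unfolding p_def using closest_point_dot[OF conv\<Omega> cl\<Omega>] by blast
        then have "t * (d \<bullet> e) \<le> 0" by (simp add: d_def)
        then have "d \<bullet> e \<le> 0" using t by (simp add: mult_le_0_iff)
        then show "u \<bullet> e \<le> 0" using nd by (simp add: u_def mult_nonneg_nonpos)
      qed
      then have "K \<tau> \<le> G u + Q u" by (rule K(2))
      moreover have "\<kappa> \<le> K \<tau>" unfolding \<kappa>_def using fin by (intro Min_le) (auto simp: \<tau>_def)
      ultimately have \<kappa>le: "\<kappa> \<le> G u + Q u" by simp
      define \<sigma> where "\<sigma> = min (norm d) ((norm d)\<^sup>2)"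
      have \<sigma>: "0 \<le> \<sigma>" "\<sigma> \<le> norm d" "\<sigma> \<le> (norm d)\<^sup>2" by (auto simp: \<sigma>_def)
      have "\<kappa> * \<sigma> \<le> (G u + Q u) * \<sigma>" using \<kappa>le \<sigma> by (intro mult_right_mono)
      also have "\<dots> = \<sigma> * G u + \<sigma> * Q u" by (simp add: algebra_simps)
      also have "\<dots> \<le> norm d * G u + (norm d)\<^sup>2 * Q u"
        using \<open>u \<in> C \<tau>\<close> Qpos[of u] \<sigma> by (intro add_mono mult_right_mono) (auto simp: C_def)
      also have "\<dots> = q w - q p0" using gap Gscale[of "norm d" u] Qscale[of "norm d" u] du by simp
      finally show ?thesis using pP unfolding \<sigma>_def d_def by blast
    qed
  qed
  with \<kappa> show ?thesis by blast
qed

section \<open>Local growth of convex piecewise quadratic functions\<close>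

text \<open>Unlike \<^const>\<open>piecewise_convex_quadratic\<close>, this class contains the piecewise linear
  norms. Sums, nonnegative multiples and compositions with linear functionals do not leave it.\<close>

definition pieces_convex_quadratic :: "('a::euclidean_space \<Rightarrow> real) \<Rightarrow> bool" where
  "pieces_convex_quadratic g \<longleftrightarrow>
     (\<exists>\<P>. finite \<P> \<and> (\<forall>P\<in>\<P>. polyhedron P) \<and> \<Union>\<P> = UNIV \<and>
        (\<forall>P\<in>\<P>. \<exists>q. quadratic_function q \<and> convex_on UNIV q \<and> (\<forall>x\<in>P. g x = q x)))"

lemma min_value_eq:
  assumes "p \<in> minimizers F"
  shows "min_value F = (F p :: real)"
  unfolding min_value_def
  using assms by (intro cInf_eq_minimum) (auto simp: minimizers_def)

lemma minimizers_closed_convex: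
  fixes F :: "'a::euclidean_space \<Rightarrow> real"
  assumes "convex_on UNIV F"
  shows "closed (minimizers F)" "convex (minimizers F)"
proof -
  have cont: "continuous_on UNIV F" using convex_on_continuous[OF open_UNIV assms] .
  have eq: "minimizers F = (\<Inter>u. {v. F v \<le> F u})" by (auto simp: minimizers_def)
  show "closed (minimizers F)"
    unfolding eq using cont by (intro closed_INT ballI closed_Collect_le) auto
  show "convex (minimizers F)"
    unfolding eq using assms by (intro convex_INT convex_lower_level_set) auto
qed

text \<open>The points of the segment from \<open>w\<close> to its projection onto the minimizers have the same
  projection, and by convexity the gap in value grows at least linearly along it. This turns a
  growth estimate at a fixed level \<open>h\<close> into one at higher levels.\<close>

lemma point_towards_minimizer:
  fixes F :: "'a::euclidean_space \<Rightarrow> real"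
  assumes F: "convex_on UNIV F" and ne: "minimizers F \<noteq> {}"
    and h: "0 < h" "h \<le> F w - min_value F"
  defines "p \<equiv> closest_point (minimizers F) w"
  obtains u where "F u - min_value F = h" "closest_point (minimizers F) u = p"
    "norm (w - p) = norm (w - u) + norm (u - p)"
    "norm (w - p) * h \<le> norm (u - p) * (F w - min_value F)"
proof -
  note cc = minimizers_closed_convex[OF F]
  have cont: "continuous_on UNIV F" using convex_on_continuous[OF open_UNIV F] .
  have p: "p \<in> minimizers F" unfolding p_def by (rule closest_point_in_set[OF cc(1) ne])
  have Fp: "F p = min_value F" using min_value_eq[OF p] by simp
  define \<phi> where "\<phi> s = F (p + s *\<^sub>R (w - p)) - min_value F" for s
  have "continuous_on {0..1} \<phi>"
    unfolding \<phi>_def by (intro continuous_intros continuous_on_compose2[OF cont]) auto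
  moreover have "\<phi> 0 \<le> h" "h \<le> \<phi> 1" using h Fp by (auto simp: \<phi>_def)
  ultimately obtain s where s: "0 \<le> s" "s \<le> 1" "\<phi> s = h" using IVT'[of \<phi> 0 h 1] by auto
  define u where "u = p + s *\<^sub>R (w - p)"
  have uc: "u = (1 - s) *\<^sub>R p + s *\<^sub>R w" by (simp add: u_def algebra_simps)
  have "closest_point (minimizers F) u = p"
  proof (rule closest_point_unique[OF cc(2,1) p, symmetric])
    show "\<forall>z\<in>minimizers F. dist u p \<le> dist u z"
    proof
      fix z assume z: "z \<in> minimizers F"
      have "(w - p) \<bullet> (z - p) \<le> 0" unfolding p_def using closest_point_dot[OF cc(2,1) z] .
      then have "s * ((w - p) \<bullet> (z - p)) \<le> 0" using s by (simp add: mult_nonneg_nonpos)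
      then have "(u - p) \<bullet> (z - p) \<le> 0" by (simp add: u_def)
      then have "(norm (u - p))\<^sup>2 \<le> (norm (u - z))\<^sup>2"
        using inner_ge_zero[of "z - p"]
        by (simp add: power2_norm_eq_inner inner_diff inner_commute algebra_simps)
      then show "dist u p \<le> dist u z" by (simp add: dist_norm norm_le_square power2_le_imp_le)
    qed
  qed
  moreover have nu: "norm (u - p) = s * norm (w - p)" using s by (simp add: u_def)
  moreover have "norm (w - u) = (1 - s) * norm (w - p)"
  proof -
    have "w - u = (1 - s) *\<^sub>R (w - p)" by (simp add: u_def algebra_simps)
    then show ?thesis using s by simp
  qed
  moreover have "norm (w - p) * h \<le> norm (u - p) * (F w - min_value F)"
  proof -
    have "F u \<le> (1 - s) * F p + s * F w" unfolding uc using convex_onD[OF F] s by auto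
    then have "h \<le> s * (F w - min_value F)"
      using s(3) unfolding \<phi>_def u_def[symmetric] Fp by (simp add: algebra_simps)
    then have "norm (w - p) * h \<le> norm (w - p) * (s * (F w - min_value F))"
      by (intro mult_left_mono) auto
    then show ?thesis unfolding nu by (simp add: algebra_simps)
  qed
  moreover have "F u - min_value F = h" using s(3) by (simp add: \<phi>_def u_def)
  ultimately show ?thesis using that[of u] by (simp add: algebra_simps)
qed

text \<open>On a piece that contains a minimizer of \<open>F\<close>, the error bound for polyhedra applies; on any other
  piece \<open>F\<close> stays a fixed amount above its minimum, because it attains its infimum there. So below a
  small level \<open>h\<close> only pieces of the first kind occur, and the distance to the minimizers is at most a
  multiple of the larger of the gap and its square root. Between \<open>h\<close> and \<open>\<epsilon>\<close>, moving
  towards the minimizers down to level \<open>h\<close> costs only a constant factor.\<close>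

lemma local_growth_pieces_convex_quadratic:
  fixes F :: "'a::euclidean_space \<Rightarrow> real"
  assumes F: "convex_on UNIV F" and pcs: "pieces_convex_quadratic F" and ne: "minimizers F \<noteq> {}"
    and \<epsilon>: "\<epsilon> > 0"
  shows "\<exists>c>0. local_growth F (1/2) c \<epsilon>"
proof -
  note cc = minimizers_closed_convex[OF F]
  let ?m = "min_value F"
  have cl: "closest_point (minimizers F) w \<in> minimizers F" for w
    by (rule closest_point_in_set[OF cc(1) ne])
  have Fge: "?m \<le> F w" for w using min_value_eq[OF cl] cl by (auto simp: minimizers_def)
  have minI: "p \<in> minimizers F" if "F p = ?m" for p using that Fge by (simp add: minimizers_def)
  from pcs obtain \<P> where \<P>0: "finite \<P>" "\<forall>P\<in>\<P>. polyhedron P" "\<Union>\<P> = UNIV"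
    and pcs': "\<forall>P\<in>\<P>. \<exists>q. quadratic_function q \<and> convex_on UNIV q \<and> (\<forall>x\<in>P. F x = q x)"
    unfolding pieces_convex_quadratic_def by (elim exE conjE)
  note \<P> = \<P>0(1) bspec[OF \<P>0(2)] \<P>0(3)
  from bchoice[OF pcs'] obtain q where
    "\<forall>P\<in>\<P>. quadratic_function (q P) \<and> convex_on UNIV (q P) \<and> (\<forall>x\<in>P. F x = q P x)"
    by (elim exE)
  then have q: "\<And>P. P \<in> \<P> \<Longrightarrow> quadratic_function (q P)"
    "\<And>P. P \<in> \<P> \<Longrightarrow> convex_on UNIV (q P)" "\<And>P x. P \<in> \<P> \<Longrightarrow> x \<in> P \<Longrightarrow> F x = q P x"
    by blast+
  let ?d = "\<lambda>w. norm (w - closest_point (minimizers F) w)"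
  have dle: "?d w \<le> norm (w - p)" if "p \<in> minimizers F" for w p
    using closest_point_le[OF cc(1) that] by (simp add: dist_norm)
  have piece: "\<exists>\<kappa>>0. \<exists>h>0. \<forall>w\<in>P. F w - ?m < h \<longrightarrow> \<kappa> * min (?d w) ((?d w)\<^sup>2) \<le> F w - ?m"
    if P: "P \<in> \<P>" for P
  proof (cases "P = {}")
    case True
    then show ?thesis by (auto intro: exI[of _ 1])
  next
    case False
    have "\<And>x. x \<in> P \<Longrightarrow> ?m \<le> q P x" using Fge q(3)[OF P] by metis
    then obtain p0 where p0: "p0 \<in> P" "\<forall>x\<in>P. q P p0 \<le> q P x"
      using frank_wolfe[OF \<P>(2)[OF P] False q(1)[OF P] q(2)[OF P]] by blast
    show ?thesis
    proof (cases "F p0 = ?m")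
      case True
      obtain \<kappa> where \<kappa>: "\<kappa> > 0" "\<And>w. w \<in> P \<Longrightarrow> \<exists>p\<in>P. q P p = q P p0 \<and>
           \<kappa> * min (norm (w - p)) ((norm (w - p))\<^sup>2) \<le> q P w - q P p0"
        using quadratic_growth_on_polyhedron[OF \<P>(2)[OF P] q(1)[OF P] q(2)[OF P] p0(1)] p0(2) by blast
      have "\<kappa> * min (?d w) ((?d w)\<^sup>2) \<le> F w - ?m" if w: "w \<in> P" for w
      proof -
        obtain p where p: "p \<in> P" "q P p = q P p0"
          "\<kappa> * min (norm (w - p)) ((norm (w - p))\<^sup>2) \<le> q P w - q P p0" using \<kappa>(2)[OF w] by blast
        have "p \<in> minimizers F" using p p0 True q(3)[OF P] minI by metis
        then have le: "?d w \<le> norm (w - p)" by (rule dle)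
        have "\<kappa> * min (?d w) ((?d w)\<^sup>2) \<le> \<kappa> * min (norm (w - p)) ((norm (w - p))\<^sup>2)"
          using le \<kappa>(1) by (intro mult_left_mono min.mono power_mono) auto
        also have "\<dots> \<le> F w - ?m" using p(3) q(3)[OF P] w p0 True by metis
        finally show ?thesis .
      qed
      with \<kappa>(1) show ?thesis by (intro exI[of _ \<kappa>] conjI exI[of _ 1]) auto
    next
      case False
      then have "F p0 - ?m > 0" using Fge[of p0] by simp
      moreover have "\<not> F w - ?m < F p0 - ?m" if "w \<in> P" for w
        using p0 q(3)[OF P] that by (simp add: not_less)
      ultimately show ?thesis by (intro exI[of _ 1] conjI exI[of _ "F p0 - ?m"]) auto
    qed
  qed
  then have "\<forall>P\<in>\<P>. \<exists>\<kappa>. \<kappa> > 0 \<and> (\<exists>h>0. \<forall>w\<in>P. F w - ?m < h \<longrightarrow> \<kappa> * min (?d w) ((?d w)\<^sup>2) \<le> F w - ?m)"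
    by blast
  then obtain K where K: "\<forall>P\<in>\<P>. K P > 0 \<and> (\<exists>h>0. \<forall>w\<in>P. F w - ?m < h \<longrightarrow> K P * min (?d w) ((?d w)\<^sup>2) \<le> F w - ?m)"
    by (elim bchoice[THEN exE])
  then have "\<forall>P\<in>\<P>. \<exists>h. h > 0 \<and> (\<forall>w\<in>P. F w - ?m < h \<longrightarrow> K P * min (?d w) ((?d w)\<^sup>2) \<le> F w - ?m)"
    by blast
  then obtain H where "\<forall>P\<in>\<P>. H P > 0 \<and> (\<forall>w\<in>P. F w - ?m < H P \<longrightarrow> K P * min (?d w) ((?d w)\<^sup>2) \<le> F w - ?m)"
    by (elim bchoice[THEN exE])
  with K have KH: "\<And>P. P \<in> \<P> \<Longrightarrow> K P > 0" "\<And>P. P \<in> \<P> \<Longrightarrow> H P > 0"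
    "\<And>P w. P \<in> \<P> \<Longrightarrow> w \<in> P \<Longrightarrow> F w - ?m < H P \<Longrightarrow> K P * min (?d w) ((?d w)\<^sup>2) \<le> F w - ?m"
    by blast+
  define \<kappa> where "\<kappa> = Min (insert 1 (K ` \<P>))"
  define h where "h = Min (insert \<epsilon> (H ` \<P>)) / 2"
  have \<kappa>: "\<kappa> > 0" "\<And>P. P \<in> \<P> \<Longrightarrow> \<kappa> \<le> K P" using KH(1) \<P>(1) by (auto simp: \<kappa>_def)
  have h0: "Min (insert \<epsilon> (H ` \<P>)) > 0" using KH(2) \<P>(1) \<epsilon> by auto
  have h1: "Min (insert \<epsilon> (H ` \<P>)) \<le> \<epsilon>" "\<And>P. P \<in> \<P> \<Longrightarrow> Min (insert \<epsilon> (H ` \<P>)) \<le> H P"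
    using \<P>(1) by auto
  have h: "h > 0" "h \<le> \<epsilon>" "\<And>P. P \<in> \<P> \<Longrightarrow> h < H P"
    using h0 h1 \<epsilon> unfolding h_def by (simp, simp, fastforce)
  define C where "C = 1 / sqrt \<kappa> + sqrt \<epsilon> / \<kappa>"
  have C: "C > 0" using \<kappa> \<epsilon> by (simp add: C_def add_pos_pos)
  \<comment> \<open>near the minimizers: the linear and the quadratic regime\<close>
  have near: "?d w \<le> C * sqrt (F w - ?m)" if w: "F w - ?m \<le> h" for w
  proof -
    let ?\<Delta> = "F w - ?m"
    have \<Delta>: "0 \<le> ?\<Delta>" "?\<Delta> \<le> \<epsilon>" using Fge w h(2) by (auto intro: order_trans)
    obtain P where P: "P \<in> \<P>" "w \<in> P" using \<P>(3) by blast
    have "\<kappa> * min (?d w) ((?d w)\<^sup>2) \<le> K P * min (?d w) ((?d w)\<^sup>2)"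
      using \<kappa>(2)[OF P(1)] by (intro mult_right_mono) auto
    also have "\<dots> \<le> ?\<Delta>" using KH(3)[OF P] h(3)[OF P(1)] w by simp
    finally have le: "min (?d w) ((?d w)\<^sup>2) \<le> ?\<Delta> / \<kappa>" using \<kappa>(1) by (simp add: field_simps)
    have "?d w \<le> ?\<Delta> / \<kappa> \<or> (?d w)\<^sup>2 \<le> ?\<Delta> / \<kappa>" using le by (auto simp: min_def split: if_splits)
    then show ?thesis
    proof
      assume "?d w \<le> ?\<Delta> / \<kappa>"
      also have "?\<Delta> / \<kappa> = sqrt ?\<Delta> * sqrt ?\<Delta> / \<kappa>" using \<Delta> by simp
      also have "\<dots> \<le> sqrt \<epsilon> * sqrt ?\<Delta> / \<kappa>"
        using \<Delta> \<kappa>(1) by (intro divide_right_mono mult_right_mono) auto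
      also have "\<dots> \<le> C * sqrt ?\<Delta>" using \<kappa>(1) \<Delta> by (simp add: C_def field_simps)
      finally show ?thesis .
    next
      assume "(?d w)\<^sup>2 \<le> ?\<Delta> / \<kappa>"
      then have "?d w \<le> sqrt (?\<Delta> / \<kappa>)" by (rule real_le_rsqrt)
      also have "\<dots> = 1 / sqrt \<kappa> * sqrt ?\<Delta>" by (simp add: real_sqrt_divide)
      also have "\<dots> \<le> C * sqrt ?\<Delta>" using \<kappa>(1) \<Delta> \<epsilon> by (intro mult_right_mono) (auto simp: C_def)
      finally show ?thesis .
    qed
  qed
  define c where "c = C * sqrt \<epsilon> / sqrt h"
  have c: "c > 0" using C \<epsilon> h(1) by (simp add: c_def)
  have Cc: "C \<le> c" using C h(1,2) by (simp add: c_def field_simps)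
  have "local_growth F (1/2) c \<epsilon>"
    unfolding local_growth_def
  proof
    fix w assume "w \<in> sublevel F \<epsilon>"
    then have w: "F w - ?m \<le> \<epsilon>" by (simp add: sublevel_def)
    have w0: "0 \<le> F w - ?m" using Fge[of w] by simp
    have "?d w \<le> c * sqrt (F w - ?m)"
    proof (cases "F w - ?m \<le> h")
      case True
      then have "?d w \<le> C * sqrt (F w - ?m)" by (rule near)
      also have "\<dots> \<le> c * sqrt (F w - ?m)" using Cc w0 by (intro mult_right_mono) auto
      finally show ?thesis .
    next
      case False
      let ?\<Delta> = "F w - ?m" and ?p = "closest_point (minimizers F) w"
      obtain u where u: "F u - ?m = h" "closest_point (minimizers F) u = ?p"
        "norm (w - ?p) * h \<le> norm (u - ?p) * ?\<Delta>"
        using point_towards_minimizer[OF F ne h(1), of w] False by (metis linear)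
      have "norm (u - ?p) \<le> C * sqrt h" using near[of u] u(1,2) by simp
      then have "norm (u - ?p) * ?\<Delta> \<le> C * sqrt h * ?\<Delta>" using w0 by (intro mult_right_mono)
      also have "\<dots> = C * sqrt h * (sqrt ?\<Delta> * sqrt ?\<Delta>)" using w0 by simp
      also have "\<dots> \<le> C * sqrt h * (sqrt \<epsilon> * sqrt ?\<Delta>)"
        using w w0 C h(1) by (intro mult_left_mono mult_right_mono) auto
      finally have "norm (w - ?p) * h \<le> C * sqrt h * (sqrt \<epsilon> * sqrt ?\<Delta>)" using u(3) by simp
      moreover have "C * sqrt h * (sqrt \<epsilon> * sqrt ?\<Delta>) = c * sqrt ?\<Delta> * h"
      proof -
        have "C * sqrt h * (sqrt \<epsilon> * sqrt ?\<Delta>) = (C * sqrt \<epsilon>) * sqrt ?\<Delta> * sqrt h" by simp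
        also have "C * sqrt \<epsilon> = c * sqrt h" using h(1) by (simp add: c_def)
        also have "c * sqrt h * sqrt ?\<Delta> * sqrt h = c * sqrt ?\<Delta> * (sqrt h * sqrt h)" by (simp only: ac_simps)
        also have "sqrt h * sqrt h = h" using h(1) by simp
        finally show ?thesis .
      qed
      ultimately show ?thesis using h(1) by simp
    qed
    then show "?d w \<le> c * (F w - ?m) powr (1/2)" using w0 by (simp add: powr_half_sqrt)
  qed
  with c show ?thesis by blast
qed

section \<open>The regularized risk is convex and piecewise quadratic\<close>

lemma quadratic_functionI:
  fixes b :: "'a::euclidean_space"
  assumes "\<And>x. q x = b \<bullet> x + c"
  shows "quadratic_function q" "convex_on UNIV q"
proof -
  show "quadratic_function q"
    unfolding quadratic_function_def
    by (rule exI[of _ "\<lambda>_. 0"], rule exI[of _ b], rule exI[of _ c])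
      (use assms in \<open>auto simp: module_hom_zero\<close>)
  show "convex_on UNIV q"
    by (intro convex_onI) (simp_all add: assms inner_add algebra_simps)
qed

lemma quadratic_function_add:
  assumes "quadratic_function p" "quadratic_function q"
  shows "quadratic_function (\<lambda>x. p x + q x)"
proof -
  obtain A b c where 1: "linear A" "\<And>x. p x = x \<bullet> A x + b \<bullet> x + c"
    using assms(1) unfolding quadratic_function_def by blast
  obtain A' b' c' where 2: "linear A'" "\<And>x. q x = x \<bullet> A' x + b' \<bullet> x + c'"
    using assms(2) unfolding quadratic_function_def by blast
  show ?thesis
    unfolding quadratic_function_def
    by (rule exI[of _ "\<lambda>x. A x + A' x"], rule exI[of _ "b + b'"], rule exI[of _ "c + c'"])
      (use 1 2 in \<open>auto simp: linear_compose_add inner_add\<close>)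
qed

lemma quadratic_function_cmult:
  assumes "quadratic_function q"
  shows "quadratic_function (\<lambda>x. a * q x)"
proof -
  obtain A b c where 1: "linear A" "\<And>x. q x = x \<bullet> A x + b \<bullet> x + c"
    using assms(1) unfolding quadratic_function_def by blast
  show ?thesis
    unfolding quadratic_function_def
    by (rule exI[of _ "\<lambda>x. a *\<^sub>R A x"], rule exI[of _ "a *\<^sub>R b"], rule exI[of _ "a * c"])
      (use 1 in \<open>auto simp: linear_compose_scale_right algebra_simps\<close>)
qed

lemma quadratic_function_inner:
  fixes v :: "'a::euclidean_space"
  assumes "quadratic_function (q :: real \<Rightarrow> real)"
  shows "quadratic_function (\<lambda>x. q (x \<bullet> v))"
proof -
  obtain A b c where 1: "linear A" "\<And>x. q x = x \<bullet> A x + b \<bullet> x + c"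
    using assms(1) unfolding quadratic_function_def by blast
  have A: "A z = z * A 1" for z using linear_scale[OF 1(1), of z 1] by simp
  have "linear (\<lambda>x. ((x \<bullet> v) * A 1) *\<^sub>R v)"
    by (rule linearI) (simp_all add: inner_add algebra_simps)
  moreover have "q (x \<bullet> v) = x \<bullet> (((x \<bullet> v) * A 1) *\<^sub>R v) + (b *\<^sub>R v) \<bullet> x + c" for x
    unfolding 1(2) using A[of "x \<bullet> v"] by (simp add: inner_commute)
  ultimately show ?thesis unfolding quadratic_function_def by blast
qed

lemma convex_on_compose_inner:
  assumes "convex_on UNIV (q :: real \<Rightarrow> real)"
  shows "convex_on UNIV (\<lambda>x. q (x \<bullet> v))"
  using convex_onD[OF assms] by (intro convex_onI) (auto simp: inner_add)

lemma polyhedron_vimage_inner: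
  fixes v :: "'a::euclidean_space"
  assumes "polyhedron (P :: real set)"
  shows "polyhedron {x. x \<bullet> v \<in> P}"
proof -
  obtain I where I: "finite I" "P = {z. \<forall>i\<in>I. fst i \<bullet> z \<le> snd i}"
    using assms polyhedron_iff_inequalities by blast
  have "{x. x \<bullet> v \<in> P} = {x. \<forall>i\<in>(\<lambda>i. (fst i *\<^sub>R v, snd i)) ` I. fst i \<bullet> x \<le> snd i}"
    unfolding I(2) by (simp add: inner_commute[of _ v])
  then show ?thesis unfolding polyhedron_iff_inequalities using I(1) by blast
qed

lemma pieces_convex_quadratic_inner:
  fixes v :: "'a::euclidean_space"
  assumes "pieces_convex_quadratic (h :: real \<Rightarrow> real)"
  shows "pieces_convex_quadratic (\<lambda>x. h (x \<bullet> v))"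
proof -
  from assms obtain \<P> where \<P>: "finite \<P>" "\<forall>P\<in>\<P>. polyhedron P" "\<Union>\<P> = UNIV"
    and q: "\<forall>P\<in>\<P>. \<exists>q. quadratic_function q \<and> convex_on UNIV q \<and> (\<forall>x\<in>P. h x = q x)"
    unfolding pieces_convex_quadratic_def by (elim exE conjE)
  show ?thesis
    unfolding pieces_convex_quadratic_def
  proof (rule exI[of _ "(\<lambda>P. {x. x \<bullet> v \<in> P}) ` \<P>"], intro conjI ballI)
    show "\<Union> ((\<lambda>P. {x. x \<bullet> v \<in> P}) ` \<P>) = UNIV" using \<P>(3) by auto
    fix S assume "S \<in> (\<lambda>P. {x. x \<bullet> v \<in> P}) ` \<P>"
    then obtain P where P: "P \<in> \<P>" "S = {x. x \<bullet> v \<in> P}" by blast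
    show "polyhedron S" using P \<P>(2) polyhedron_vimage_inner by blast
    obtain q where "quadratic_function q" "convex_on UNIV q" "\<forall>x\<in>P. h x = q x"
      using bspec[OF q P(1)] by (elim exE conjE)
    then show "\<exists>q. quadratic_function q \<and> convex_on UNIV q \<and> (\<forall>x\<in>S. h (x \<bullet> v) = q x)"
      using P(2) by (intro exI[of _ "\<lambda>x. q (x \<bullet> v)"])
        (simp add: quadratic_function_inner convex_on_compose_inner)
  qed (use \<P>(1) in simp)
qed

lemma pieces_convex_quadratic_add:
  assumes "pieces_convex_quadratic f" "pieces_convex_quadratic g"
  shows "pieces_convex_quadratic (\<lambda>x. f x + g x)"
proof -
  from assms(1) obtain \<P> where \<P>: "finite \<P>" "\<forall>P\<in>\<P>. polyhedron P" "\<Union>\<P> = UNIV"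
    and p: "\<forall>P\<in>\<P>. \<exists>q. quadratic_function q \<and> convex_on UNIV q \<and> (\<forall>x\<in>P. f x = q x)"
    unfolding pieces_convex_quadratic_def by (elim exE conjE)
  from assms(2) obtain \<Q> where \<Q>: "finite \<Q>" "\<forall>P\<in>\<Q>. polyhedron P" "\<Union>\<Q> = UNIV"
    and q: "\<forall>P\<in>\<Q>. \<exists>q. quadratic_function q \<and> convex_on UNIV q \<and> (\<forall>x\<in>P. g x = q x)"
    unfolding pieces_convex_quadratic_def by (elim exE conjE)
  show ?thesis
    unfolding pieces_convex_quadratic_def
  proof (rule exI[of _ "(\<lambda>(P, Q). P \<inter> Q) ` (\<P> \<times> \<Q>)"], intro conjI ballI)
    show "\<Union> ((\<lambda>(P, Q). P \<inter> Q) ` (\<P> \<times> \<Q>)) = UNIV"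
    proof (intro equalityI subsetI UNIV_I)
      fix x
      obtain P Q where "P \<in> \<P>" "x \<in> P" "Q \<in> \<Q>" "x \<in> Q" using \<P>(3) \<Q>(3) by blast
      then show "x \<in> \<Union> ((\<lambda>(P, Q). P \<inter> Q) ` (\<P> \<times> \<Q>))" by force
    qed
    fix S assume "S \<in> (\<lambda>(P, Q). P \<inter> Q) ` (\<P> \<times> \<Q>)"
    then obtain P Q where S: "P \<in> \<P>" "Q \<in> \<Q>" "S = P \<inter> Q" by blast
    show "polyhedron S" using S \<P>(2) \<Q>(2) by simp
    obtain p' where p': "quadratic_function p'" "convex_on UNIV p'" "\<forall>x\<in>P. f x = p' x"
      using bspec[OF p S(1)] by (elim exE conjE)
    obtain q' where q': "quadratic_function q'" "convex_on UNIV q'" "\<forall>x\<in>Q. g x = q' x"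
      using bspec[OF q S(2)] by (elim exE conjE)
    show "\<exists>q. quadratic_function q \<and> convex_on UNIV q \<and> (\<forall>x\<in>S. f x + g x = q x)"
      using S(3) p' q' by (intro exI[of _ "\<lambda>x. p' x + q' x"])
        (simp add: quadratic_function_add convex_on_add)
  qed (use \<P>(1) \<Q>(1) in simp)
qed

lemma pieces_convex_quadratic_cmult:
  assumes "pieces_convex_quadratic f" "a \<ge> 0"
  shows "pieces_convex_quadratic (\<lambda>x. a * f x)"
proof -
  from assms(1) obtain \<P> where \<P>: "finite \<P>" "\<forall>P\<in>\<P>. polyhedron P" "\<Union>\<P> = UNIV"
    and p: "\<forall>P\<in>\<P>. \<exists>q. quadratic_function q \<and> convex_on UNIV q \<and> (\<forall>x\<in>P. f x = q x)"
    unfolding pieces_convex_quadratic_def by (elim exE conjE)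
  have "\<exists>q. quadratic_function q \<and> convex_on UNIV q \<and> (\<forall>x\<in>P. a * f x = q x)" if P: "P \<in> \<P>" for P
  proof -
    obtain q where "quadratic_function q" "convex_on UNIV q" "\<forall>x\<in>P. f x = q x"
      using bspec[OF p P] by (elim exE conjE)
    then show ?thesis using assms(2)
      by (intro exI[of _ "\<lambda>x. a * q x"]) (simp add: quadratic_function_cmult convex_on_cmul)
  qed
  with \<P> show ?thesis
    unfolding pieces_convex_quadratic_def by (intro exI[of _ \<P>] conjI ballI) simp_all
qed

lemma pieces_convex_quadratic_sum:
  fixes f :: "'i \<Rightarrow> 'a::euclidean_space \<Rightarrow> real"
  assumes "finite A" "\<And>i. i \<in> A \<Longrightarrow> pieces_convex_quadratic (f i)"
  shows "pieces_convex_quadratic (\<lambda>x. \<Sum>i\<in>A. f i x)"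
  using assms
proof (induction A rule: finite_induct)
  case empty
  have "\<exists>q. quadratic_function q \<and> convex_on UNIV q \<and> (\<forall>x\<in>UNIV. (0::real) = q (x :: 'a))"
    using quadratic_functionI[of "\<lambda>_. 0" "0 :: 'a" 0] by (intro exI[of _ "\<lambda>_. 0"]) simp
  then show ?case unfolding pieces_convex_quadratic_def by (intro exI[of _ "{UNIV}"]) simp
next
  case (insert i A)
  then show ?case by (simp add: pieces_convex_quadratic_add)
qed

lemma convex_on_finite_sum:
  assumes "finite A" "\<And>i. i \<in> A \<Longrightarrow> convex_on UNIV (f i)"
  shows "convex_on UNIV (\<lambda>x. \<Sum>i\<in>A. f i x :: real)"
  using assms
  by (induction A rule: finite_induct) (auto simp: convex_on_const intro: convex_on_add)

lemma convex_on_if_subgradients: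
  fixes f :: "'a::real_inner \<Rightarrow> real"
  assumes "\<And>w. is_subgradient f w (g w)"
  shows "convex_on UNIV f"
proof (rule convex_onI)
  fix t :: real and x y :: 'a
  assume t: "0 < t" "t < 1"
  define z where "z = (1 - t) *\<^sub>R x + t *\<^sub>R y"
  have "(1 - t) * (f z + g z \<bullet> (x - z)) + t * (f z + g z \<bullet> (y - z)) \<le> (1 - t) * f x + t * f y"
    using assms[of z] t unfolding is_subgradient_def by (intro add_mono mult_left_mono) auto
  moreover have "(1 - t) * (g z \<bullet> (x - z)) + t * (g z \<bullet> (y - z)) = g z \<bullet> ((1 - t) *\<^sub>R x + t *\<^sub>R y - z)"
    by (simp add: inner_add inner_diff algebra_simps)
  ultimately show "f ((1 - t) *\<^sub>R x + t *\<^sub>R y) \<le> (1 - t) * f x + t * f y"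
    by (simp add: z_def algebra_simps)
qed simp

text \<open>A maximum of finitely many linear functions is linear on each of the polyhedra where one of them
  dominates, and the dominating function is a subgradient.\<close>

lemma support_function_properties:
  fixes S :: "'a::euclidean_space set"
  assumes "finite S" and ub: "\<And>a x. a \<in> S \<Longrightarrow> a \<bullet> x \<le> h x" and att: "\<And>x. \<exists>a\<in>S. h x = a \<bullet> x"
  shows "convex_on UNIV h" "pieces_convex_quadratic h"
proof -
  obtain g where g: "\<And>x. g x \<in> S \<and> h x = g x \<bullet> x" using att by metis
  show "convex_on UNIV h"
    by (rule convex_on_if_subgradients[of _ g]) (use g ub in \<open>simp add: is_subgradient_def inner_diff_right\<close>)
  define C where "C a = {x. \<forall>i\<in>(\<lambda>a'. (a' - a, 0)) ` S. fst i \<bullet> x \<le> snd i}" for a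
  have C: "x \<in> C a \<longleftrightarrow> h x = a \<bullet> x" if "a \<in> S" for a x
    using that ub[of _ x] g[of x] by (force simp: C_def inner_diff_left)
  show "pieces_convex_quadratic h"
    unfolding pieces_convex_quadratic_def
  proof (rule exI[of _ "C ` S"], intro conjI ballI)
    show "\<Union> (C ` S) = UNIV" using C g by blast
    fix P assume "P \<in> C ` S"
    then obtain a where a: "a \<in> S" "P = C a" by blast
    show "polyhedron P" unfolding a(2) polyhedron_iff_inequalities C_def using assms(1) by blast
    show "\<exists>q. quadratic_function q \<and> convex_on UNIV q \<and> (\<forall>x\<in>P. h x = q x)"
      using quadratic_functionI[of "\<lambda>x. a \<bullet> x" a 0] C[OF a(1)] a(2)
      by (intro exI[of _ "\<lambda>x. a \<bullet> x"]) simp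
  qed (use assms in simp)
qed

text \<open>With coordinate vectors for \<open>S\<close>, these are the building blocks of all three norms: one
  coordinate for \<open>\<ell>\<^sub>1\<close>, all coordinates for \<open>\<ell>\<^sub>\<infinity>\<close>, one block for \<open>\<ell>\<^sub>1\<^sub>,\<^sub>\<infinity>\<close>.\<close>

lemma abs_support_properties:
  fixes S :: "'a::euclidean_space set"
  assumes "finite S" "S \<noteq> {}"
  shows "convex_on UNIV (\<lambda>x. Max ((\<lambda>a. \<bar>a \<bullet> x\<bar>) ` S))"
    "pieces_convex_quadratic (\<lambda>x. Max ((\<lambda>a. \<bar>a \<bullet> x\<bar>) ` S))"
proof -
  have 1: "finite (S \<union> uminus ` S)" using assms by simp
  have 2: "a \<bullet> x \<le> Max ((\<lambda>a. \<bar>a \<bullet> x\<bar>) ` S)" if "a \<in> S \<union> uminus ` S" for a x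
  proof -
    obtain b where "b \<in> S" "a = b \<or> a = - b" using \<open>a \<in> S \<union> uminus ` S\<close> by blast
    then have "a \<bullet> x \<le> \<bar>b \<bullet> x\<bar>" by auto
    also have "\<dots> \<le> Max ((\<lambda>a. \<bar>a \<bullet> x\<bar>) ` S)" using assms \<open>b \<in> S\<close> by (intro Max_ge) auto
    finally show ?thesis .
  qed
  have 3: "\<exists>a\<in>S \<union> uminus ` S. Max ((\<lambda>a. \<bar>a \<bullet> x\<bar>) ` S) = a \<bullet> x" for x
  proof -
    have "Max ((\<lambda>a. \<bar>a \<bullet> x\<bar>) ` S) \<in> (\<lambda>a. \<bar>a \<bullet> x\<bar>) ` S" using assms by (intro Max_in) auto
    then obtain b where b: "b \<in> S" "Max ((\<lambda>a. \<bar>a \<bullet> x\<bar>) ` S) = \<bar>b \<bullet> x\<bar>" by blast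
    then show ?thesis
      by (cases "0 \<le> b \<bullet> x") (auto intro: bexI[of _ b] bexI[of _ "- b"])
  qed
  show "convex_on UNIV (\<lambda>x. Max ((\<lambda>a. \<bar>a \<bullet> x\<bar>) ` S))"
    "pieces_convex_quadratic (\<lambda>x. Max ((\<lambda>a. \<bar>a \<bullet> x\<bar>) ` S))"
    by (rule support_function_properties[OF 1 2 3]; assumption)+
qed

text \<open>The Huber function is the maximum of the affine functions \<open>z \<mapsto> s z - s\<^sup>2 / 2\<close> over
  \<open>\<bar>s\<bar> \<le> \<gamma>\<close>, attained at the truncation of \<open>z\<close> to \<open>[-\<gamma>, \<gamma>]\<close>.\<close>

lemma huber_convex:
  assumes "\<gamma> > 0"
  shows "convex_on UNIV (huber \<gamma>)"
proof (rule convex_on_if_subgradients)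
  fix w
  define s where "s = max (-\<gamma>) (min \<gamma> w)"
  have eq: "huber \<gamma> w = s * w - s\<^sup>2 / 2"
    using assms by (auto simp: huber_def s_def power2_eq_square max_def min_def field_simps)
  have ge: "s * u - s\<^sup>2 / 2 \<le> huber \<gamma> u" for u
  proof (cases "\<bar>u\<bar> \<le> \<gamma>")
    case True
    have "0 \<le> (u - s)\<^sup>2 / 2" by simp
    then show ?thesis using True by (simp add: huber_def power2_diff field_simps)
  next
    case False
    have s: "\<bar>s\<bar> \<le> \<gamma>" using assms by (auto simp: s_def)
    have "s * u \<le> \<bar>s\<bar> * \<bar>u\<bar>" by (metis abs_ge_self abs_mult)
    moreover have "0 \<le> (\<gamma> - \<bar>s\<bar>) * (\<bar>u\<bar> - \<gamma>)" using s False by simp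
    moreover have "0 \<le> (\<gamma> - \<bar>s\<bar>)\<^sup>2" by simp
    ultimately have "s * u - s\<^sup>2 / 2 \<le> \<gamma> * (\<bar>u\<bar> - \<gamma> / 2)"
      by (simp add: power2_diff algebra_simps power2_eq_square[of \<gamma>])
    then show ?thesis using False by (simp add: huber_def)
  qed
  show "is_subgradient (huber \<gamma>) w (max (-\<gamma>) (min \<gamma> w))"
    unfolding is_subgradient_def s_def[symmetric] inner_real_def
  proof
    fix u
    show "huber \<gamma> w + s * (u - w) \<le> huber \<gamma> u" using eq ge[of u] by (simp add: algebra_simps)
  qed
qed

lemma huber_pieces:
  assumes \<gamma>: "\<gamma> > 0"
  shows "pieces_convex_quadratic (huber \<gamma>)"
  unfolding pieces_convex_quadratic_def
proof (rule exI[of _ "{{-\<gamma>..\<gamma>}, {..-\<gamma>}, {\<gamma>..}}"], intro conjI)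
  show "\<Union> {{-\<gamma>..\<gamma>}, {..-\<gamma>}, {\<gamma>..}} = UNIV" by auto
  have "{..-\<gamma>} = {z. 1 \<bullet> z \<le> -\<gamma>}" "{\<gamma>..} = {z. 1 \<bullet> z \<ge> \<gamma>}" by auto
  then have "polyhedron {..-\<gamma>}" "polyhedron {\<gamma>..}"
    by (simp_all only: polyhedron_halfspace_le polyhedron_halfspace_ge)
  moreover have "polyhedron {-\<gamma>..\<gamma>}" using polyhedron_interval[of "-\<gamma>" \<gamma>] by simp
  ultimately show "\<forall>P\<in>{{-\<gamma>..\<gamma>}, {..-\<gamma>}, {\<gamma>..}}. polyhedron P" by simp
  have 1: "\<exists>q. quadratic_function q \<and> convex_on UNIV q \<and> (\<forall>x\<in>{-\<gamma>..\<gamma>}. huber \<gamma> x = q x)"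
  proof (intro exI[of _ "\<lambda>z. z\<^sup>2 / 2"] conjI)
    show "quadratic_function (\<lambda>z::real. z\<^sup>2 / 2)"
      unfolding quadratic_function_def
      by (rule exI[of _ "\<lambda>z. z / 2"], rule exI[of _ 0], rule exI[of _ 0])
        (auto simp: power2_eq_square intro!: linearI)
    show "convex_on UNIV (\<lambda>z::real. z\<^sup>2 / 2)"
      using convex_on_cdiv[OF _ convex_power2, of 2] by simp
  qed (auto simp: huber_def)
  \<comment> \<open>At the break points the quadratic and the linear formula agree.\<close>
  have tail: "huber \<gamma> x = \<gamma> * \<bar>x\<bar> - \<gamma>\<^sup>2 / 2" if "\<gamma> \<le> \<bar>x\<bar>" for x
  proof (cases "\<bar>x\<bar> = \<gamma>")
    case True
    then have "x\<^sup>2 = \<gamma>\<^sup>2" by (metis power2_abs)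
    then show ?thesis using True by (simp add: huber_def power2_eq_square)
  next
    case False
    then show ?thesis using that by (simp add: huber_def power2_eq_square algebra_simps)
  qed
  have 2: "\<exists>q. quadratic_function q \<and> convex_on UNIV q \<and> (\<forall>x\<in>{..-\<gamma>}. huber \<gamma> x = q x)"
  proof (intro exI[of _ "\<lambda>z. (-\<gamma>) \<bullet> z + - \<gamma>\<^sup>2 / 2"] conjI ballI)
    fix x assume "x \<in> {..-\<gamma>}"
    then show "huber \<gamma> x = (-\<gamma>) \<bullet> x + - \<gamma>\<^sup>2 / 2"
      using \<gamma> tail[of x] by simp
  qed (rule quadratic_functionI[OF refl])+
  have 3: "\<exists>q. quadratic_function q \<and> convex_on UNIV q \<and> (\<forall>x\<in>{\<gamma>..}. huber \<gamma> x = q x)"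
  proof (intro exI[of _ "\<lambda>z. \<gamma> \<bullet> z + - \<gamma>\<^sup>2 / 2"] conjI ballI)
    fix x assume "x \<in> {\<gamma>..}"
    then show "huber \<gamma> x = \<gamma> \<bullet> x + - \<gamma>\<^sup>2 / 2"
      using \<gamma> tail[of x] by simp
  qed (rule quadratic_functionI[OF refl])+
  show "\<forall>P\<in>{{-\<gamma>..\<gamma>}, {..-\<gamma>}, {\<gamma>..}}. \<exists>q. quadratic_function q \<and> convex_on UNIV q \<and> (\<forall>x\<in>P. huber \<gamma> x = q x)"
    using 1 2 3 by simp
qed simp

lemma admissible_regularizer_properties:
  fixes R :: "real ^ 'd \<Rightarrow> real"
  assumes "admissible_regularizer R"
  shows "convex_on UNIV R \<and> pieces_convex_quadratic R"
proof -
  have block: "convex_on UNIV (\<lambda>w :: real ^ 'd. Max ((\<lambda>i. \<bar>w $ i\<bar>) ` B))"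
    "pieces_convex_quadratic (\<lambda>w :: real ^ 'd. Max ((\<lambda>i. \<bar>w $ i\<bar>) ` B))"
    if "B \<noteq> {}" for B :: "'d set"
    using abs_support_properties[of "(\<lambda>i. axis i 1 :: real ^ 'd) ` B"] that
    by (simp_all add: image_image inner_axis' del: Max_less_iff)
  show ?thesis
    using assms unfolding admissible_regularizer_def
  proof (elim disjE exE conjE)
    assume R: "R = l1_norm"
    have eq: "R = (\<lambda>w. \<Sum>i\<in>UNIV. Max ((\<lambda>i. \<bar>w $ i\<bar>) ` {i}))" by (simp add: R l1_norm_def fun_eq_iff)
    show ?thesis
      unfolding eq by (intro conjI convex_on_finite_sum pieces_convex_quadratic_sum block) simp_all
  next
    assume R: "R = infnorm"
    have "R w = Max ((\<lambda>a. \<bar>a \<bullet> w\<bar>) ` Basis)" for w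
      unfolding R infnorm_Max by (simp add: inner_commute)
    then have "R = (\<lambda>w. Max ((\<lambda>a. \<bar>a \<bullet> w\<bar>) ` Basis))" by blast
    then show ?thesis using abs_support_properties[of "Basis :: (real ^ 'd) set"] by simp
  next
    fix \<B> :: "'d set set" assume \<B>: "partition_on UNIV \<B>" and R: "R = l1_inf_norm \<B>"
    have ne: "B \<noteq> {}" if "B \<in> \<B>" for B using \<B> that by (auto simp: partition_on_def)
    have eq: "R = (\<lambda>w. \<Sum>B\<in>\<B>. Max ((\<lambda>i. \<bar>w $ i\<bar>) ` B))" by (simp add: R l1_inf_norm_def fun_eq_iff)
    show ?thesis
      unfolding eq
      by (intro conjI convex_on_finite_sum pieces_convex_quadratic_sum block ne) simp_all
  next
    fix \<gamma> :: real assume \<gamma>: "\<gamma> > 0" and R: "R = huber_norm \<gamma>"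
    have eq: "R = (\<lambda>w. \<Sum>i\<in>UNIV. huber \<gamma> (w \<bullet> axis i 1))"
      by (simp add: R huber_norm_def fun_eq_iff inner_axis)
    show ?thesis
      unfolding eq
      by (intro conjI convex_on_finite_sum pieces_convex_quadratic_sum convex_on_compose_inner
          pieces_convex_quadratic_inner huber_convex huber_pieces \<gamma>) simp_all
  qed
qed

lemma regularized_risk_properties:
  fixes x :: "nat \<Rightarrow> real ^ 'd" and loss :: "real \<Rightarrow> 'y \<Rightarrow> real"
  assumes mu: "\<mu> > 0"
    and loss_convex: "\<And>i. i \<in> {1..n} \<Longrightarrow> convex_on UNIV (\<lambda>z. loss z (y i))"
    and loss_pcq: "\<And>i. i \<in> {1..n} \<Longrightarrow> piecewise_convex_quadratic (\<lambda>z. loss z (y i))"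
    and R: "admissible_regularizer R"
  shows "convex_on UNIV (regularized_risk loss x y \<mu> R n)"
    "pieces_convex_quadratic (regularized_risk loss x y \<mu> R n)"
proof -
  note RR = admissible_regularizer_properties[OF R]
  have eq: "regularized_risk loss x y \<mu> R n = (\<lambda>w. (1 / real n) * (\<Sum>i = 1..n. loss (w \<bullet> x i) (y i)) + \<mu> * R w)"
    by (simp add: regularized_risk_def fun_eq_iff)
  have pc: "pieces_convex_quadratic (\<lambda>z. loss z (y i))" if "i \<in> {1..n}" for i
    using loss_pcq[OF that] unfolding piecewise_convex_quadratic_def pieces_convex_quadratic_def
    by (elim exE conjE) (intro exI conjI)
  show "convex_on UNIV (regularized_risk loss x y \<mu> R n)"
    unfolding eq
    by (intro convex_on_add convex_on_cmul convex_on_finite_sum convex_on_compose_inner[of "\<lambda>z. loss z (y _)"] loss_convex)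
      (use RR mu in auto)
  show "pieces_convex_quadratic (regularized_risk loss x y \<mu> R n)"
    unfolding eq
    by (intro pieces_convex_quadratic_add pieces_convex_quadratic_cmult pieces_convex_quadratic_sum
        pieces_convex_quadratic_inner[of "\<lambda>z. loss z (y _)"] pc)
      (use RR mu in auto)
qed

section \<open>A martingale inequality for uniform samples\<close>

text \<open>The default value 0 outside \<open>I\<close> is one that no sample takes.\<close>

abbreviation samples :: "nat \<Rightarrow> 'i set \<Rightarrow> ('i \<Rightarrow> nat) pmf" where
  "samples n I \<equiv> Pi_pmf I 0 (\<lambda>_. pmf_of_set {1..n})"

lemma set_samples:
  assumes "n \<ge> 1" "finite I" "s \<in> set_pmf (samples n I)" "i \<in> I"
  shows "s i \<in> {1..n}"
  using set_Pi_pmf_subset'[OF assms(2), of 0 "\<lambda>_. pmf_of_set {1..n}"] assms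
  by (auto simp: PiE_dflt_def)

lemma uniform_mgf_bound:
  fixes X :: "nat \<Rightarrow> real"
  assumes n: "n \<ge> 1" and zero: "(\<Sum>y=1..n. X y) = 0" and bd: "\<And>y. y \<in> {1..n} \<Longrightarrow> \<bar>X y\<bar> \<le> B" and l: "l > 0"
  shows "(\<integral>\<^sup>+y. ennreal (exp (l * X y)) \<partial>measure_pmf (pmf_of_set {1..n})) \<le> ennreal (exp (l\<^sup>2 * B\<^sup>2 / 2))"
proof -
  have ne: "{1..n} \<noteq> {}" "finite {1..n}" using n by auto
  interpret interval_bounded_random_variable "measure_pmf (pmf_of_set {1..n})" X "-B" B
    by unfold_locales (use ne bd in \<open>force simp: AE_measure_pmf_iff abs_le_iff\<close>)+
  have "measure_pmf.expectation (pmf_of_set {1..n}) X = 0"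
    using integral_pmf_of_set[OF ne, of X] zero by simp
  from Hoeffdings_lemma_nn_integral_0[OF l this] show ?thesis
    by (simp add: power_mult_distrib power2_eq_square mult_ac)
qed

text \<open>Step \<open>j\<close> contributes \<open>X j s (s (j + 1))\<close>, where the function \<open>X j s\<close> is determined by the first
  \<open>j\<close> samples and the sample \<open>j + 1\<close> is fresh. Averaging over the last sample first, with the
  others fixed, splits off one factor per step: the moment generating function of a martingale with
  bounded differences.\<close>

lemma adapted_sum_mgf_bound:
  fixes X :: "nat \<Rightarrow> (nat \<Rightarrow> nat) \<Rightarrow> nat \<Rightarrow> real"
  assumes n: "n \<ge> 1"
    and adapted: "\<And>j s s'. (\<And>i. i \<in> {1..j} \<Longrightarrow> s i = s' i) \<Longrightarrow> X j s = X j s'"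
    and zero: "\<And>j s. (\<Sum>y=1..n. X j s y) = 0"
    and bd: "\<And>j s y. y \<in> {1..n} \<Longrightarrow> \<bar>X j s y\<bar> \<le> B"
    and l: "l > 0"
  shows "(\<integral>\<^sup>+s. ennreal (exp (l * (\<Sum>j<m. X j s (s (Suc j))))) \<partial>measure_pmf (samples n {1..m}))
    \<le> ennreal (exp (real m * (l\<^sup>2 * B\<^sup>2 / 2)))"
proof (induction m)
  case 0
  then show ?case by simp
next
  case (Suc m)
  define S where "S = (\<lambda>m s. \<Sum>j<m. X j s (s (Suc j)))"
  have Supd: "S m (s(Suc m := y)) = S m s" for s y
    unfolding S_def
  proof (rule sum.cong[OF refl])
    fix j assume j: "j \<in> {..<m}"
    have "X j (s(Suc m := y)) = X j s" by (rule adapted) (use j in auto)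
    then show "X j (s(Suc m := y)) ((s(Suc m := y)) (Suc j)) = X j s (s (Suc j))" using j by simp
  qed
  have Xupd: "X m (s(Suc m := y)) = X m s" for s y by (rule adapted) auto
  have step: "exp (l * S (Suc m) (s(Suc m := y))) = exp (l * S m s) * exp (l * X m s y)" for s y
  proof -
    have "S (Suc m) (s(Suc m := y)) = S m (s(Suc m := y)) + X m (s(Suc m := y)) y"
      by (simp add: S_def)
    then show ?thesis by (simp only: Supd Xupd distrib_left exp_add)
  qed
  have ins: "{1..Suc m} = insert (Suc m) {1..m}" by auto
  have "(\<integral>\<^sup>+s. ennreal (exp (l * S (Suc m) s)) \<partial>measure_pmf (samples n {1..Suc m}))
    = (\<integral>\<^sup>+s. \<integral>\<^sup>+y. ennreal (exp (l * S (Suc m) (s(Suc m := y)))) \<partial>measure_pmf (pmf_of_set {1..n}) \<partial>measure_pmf (samples n {1..m}))"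
    unfolding ins by (subst Pi_pmf_insert) (simp_all add: pair_commute_pmf[of "pmf_of_set _"] nn_integral_pair_pmf')
  also have "\<dots> = (\<integral>\<^sup>+s. ennreal (exp (l * S m s)) * (\<integral>\<^sup>+y. ennreal (exp (l * X m s y)) \<partial>measure_pmf (pmf_of_set {1..n})) \<partial>measure_pmf (samples n {1..m}))"
    by (simp add: step ennreal_mult nn_integral_cmult)
  also have "\<dots> \<le> (\<integral>\<^sup>+s. ennreal (exp (l * S m s)) * ennreal (exp (l\<^sup>2 * B\<^sup>2 / 2)) \<partial>measure_pmf (samples n {1..m}))"
    by (intro nn_integral_mono mult_left_mono uniform_mgf_bound n zero bd l) auto
  also have "\<dots> = (\<integral>\<^sup>+s. ennreal (exp (l * S m s)) \<partial>measure_pmf (samples n {1..m})) * ennreal (exp (l\<^sup>2 * B\<^sup>2 / 2))"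
    by (simp add: nn_integral_multc)
  also have "\<dots> \<le> ennreal (exp (real m * (l\<^sup>2 * B\<^sup>2 / 2))) * ennreal (exp (l\<^sup>2 * B\<^sup>2 / 2))"
    using Suc unfolding S_def by (intro mult_right_mono) auto
  also have "\<dots> = ennreal (exp (real (Suc m) * (l\<^sup>2 * B\<^sup>2 / 2)))"
    by (simp add: ennreal_mult[symmetric] exp_add[symmetric] algebra_simps)
  finally show ?case by (simp add: S_def)
qed

text \<open>The exponent \<open>l = a / (T B\<^sup>2)\<close> optimizes the Chernoff bound. Any \<open>T \<ge> m\<close> is allowed, because a stage
  with \<open>t\<close> iterates uses \<open>t - 1\<close> samples but is analyzed with \<open>t\<close>.\<close>

lemma azuma_hoeffding_uniform:
  fixes X :: "nat \<Rightarrow> (nat \<Rightarrow> nat) \<Rightarrow> nat \<Rightarrow> real"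
  assumes n: "n \<ge> 1"
    and adapted: "\<And>j s s'. (\<And>i. i \<in> {1..j} \<Longrightarrow> s i = s' i) \<Longrightarrow> X j s = X j s'"
    and zero: "\<And>j s. (\<Sum>y=1..n. X j s y) = 0"
    and bd: "\<And>j s y. y \<in> {1..n} \<Longrightarrow> \<bar>X j s y\<bar> \<le> B"
    and B: "B > 0" and a: "a > 0" and T: "real m \<le> T" "T > 0"
  shows "measure_pmf.prob (samples n {1..m}) {s. a \<le> (\<Sum>j<m. X j s (s (Suc j)))} \<le> exp (- (a\<^sup>2 / (2 * T * B\<^sup>2)))"
proof -
  define l where "l = a / (T * B\<^sup>2)"
  have l: "l > 0" using a B T by (simp add: l_def)
  let ?S = "\<lambda>s. \<Sum>j<m. X j s (s (Suc j))"
  let ?M = "measure_pmf (samples n {1..m})"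
  have "emeasure ?M {s. a \<le> ?S s} = emeasure ?M {s\<in>space ?M. ?S s \<ge> a}" by simp
  also have "\<dots> \<le> ennreal (exp (- l * a)) * (\<integral>\<^sup>+s. ennreal (exp (l * ?S s)) * indicator (space ?M) s \<partial>?M)"
    by (rule Chernoff_ineq_nn_integral_ge[OF l]) auto
  also have "(\<integral>\<^sup>+s. ennreal (exp (l * ?S s)) * indicator (space ?M) s \<partial>?M) = (\<integral>\<^sup>+s. ennreal (exp (l * ?S s)) \<partial>?M)"
    by simp
  also have "ennreal (exp (- l * a)) * (\<integral>\<^sup>+s. ennreal (exp (l * ?S s)) \<partial>?M)
    \<le> ennreal (exp (- l * a)) * ennreal (exp (real m * (l\<^sup>2 * B\<^sup>2 / 2)))"
    by (intro mult_left_mono adapted_sum_mgf_bound n adapted zero bd l) auto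
  also have "\<dots> = ennreal (exp (real m * (l\<^sup>2 * B\<^sup>2 / 2) - l * a))"
    by (simp add: ennreal_mult[symmetric] exp_add[symmetric])
  finally have "measure ?M {s. a \<le> ?S s} \<le> exp (real m * (l\<^sup>2 * B\<^sup>2 / 2) - l * a)"
    by (simp add: measure_pmf.emeasure_eq_measure)
  also have "\<dots> \<le> exp (T * (l\<^sup>2 * B\<^sup>2 / 2) - l * a)" using T by (simp add: mult_right_mono)
  also have "T * (l\<^sup>2 * B\<^sup>2 / 2) - l * a = - (a\<^sup>2 / (2 * T * B\<^sup>2))"
    using T B by (simp add: l_def power2_eq_square field_simps)
  finally show ?thesis .
qed

section \<open>One stage of the projected stochastic subgradient method\<close>

lemma psg_iterate_cong:
  "(\<And>i. i \<in> {1..j} \<Longrightarrow> s i = s' i) \<Longrightarrow> psg_iterate g \<eta> D s v j = psg_iterate g \<eta> D s' v j"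
  by (induction j) auto

lemma psg_average_cong:
  assumes "\<And>i. i \<in> {1..<t} \<Longrightarrow> s i = s' i"
  shows "psg_average g \<eta> D t s v = psg_average g \<eta> D t s' v"
  unfolding psg_average_def
  using psg_iterate_cong[of _ s s' g \<eta> D v] assms by (intro arg_cong[of _ _ "scaleR _"] sum.cong) auto

lemma assg_stage_cong:
  assumes "\<And>i j. i \<in> {1..k} \<Longrightarrow> j \<in> {1..<t} \<Longrightarrow> s i j = s' i j"
  shows "assg_stage g \<eta> D t s v k = assg_stage g \<eta> D t s' v k"
  using assms
proof (induction k)
  case (Suc k)
  then have "assg_stage g \<eta> D t s v k = assg_stage g \<eta> D t s' v k" by simp
  moreover have "psg_average g \<eta>' D' t (s (Suc k)) u = psg_average g \<eta>' D' t (s' (Suc k)) u" for \<eta>' D' u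
    by (rule psg_average_cong) (use Suc.prems in auto)
  ultimately show ?case by simp
qed simp

lemma psg_iterate_in_ball: "D \<ge> 0 \<Longrightarrow> psg_iterate g \<eta> D s v j \<in> cball v D"
  by (cases j) (auto intro!: closest_point_in_set simp del: mem_cball)

locale bounded_subgradient_average =
  fixes F :: "'a::euclidean_space \<Rightarrow> real" and f :: "nat \<Rightarrow> 'a \<Rightarrow> real" and g :: "nat \<Rightarrow> 'a \<Rightarrow> 'a"
    and n :: nat and G :: real
  assumes n: "n \<ge> 1" and F_eq: "\<And>w. F w = (1 / real n) * (\<Sum>i=1..n. f i w)"
    and subgrad: "\<And>i w. i \<in> {1..n} \<Longrightarrow> is_subgradient (f i) w (g i w)"
    and bound: "\<And>i w. i \<in> {1..n} \<Longrightarrow> norm (g i w) \<le> G" and G: "G > 0"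
begin

definition mean_gradient :: "'a \<Rightarrow> 'a" where
  "mean_gradient w = (1 / real n) *\<^sub>R (\<Sum>i=1..n. g i w)"

lemma mean_subgradient: "is_subgradient F w (mean_gradient w)"
  unfolding is_subgradient_def
proof
  fix u
  have "(\<Sum>i=1..n. f i w + g i w \<bullet> (u - w)) \<le> (\<Sum>i=1..n. f i u)"
    using subgrad by (intro sum_mono) (auto simp: is_subgradient_def)
  then have "(1 / real n) * (\<Sum>i=1..n. f i w + g i w \<bullet> (u - w)) \<le> F u"
    unfolding F_eq by (intro mult_left_mono) auto
  then show "F w + mean_gradient w \<bullet> (u - w) \<le> F u"
    by (simp add: F_eq[of w] mean_gradient_def sum.distrib inner_sum_left distrib_left)
qed

lemma norm_mean_gradient: "norm (mean_gradient w) \<le> G"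
proof -
  have "norm (\<Sum>i=1..n. g i w) \<le> (\<Sum>i=1..n. G)" using bound by (intro sum_norm_le) auto
  then show ?thesis using n by (simp add: mean_gradient_def field_simps)
qed

lemma convex_objective: "convex_on UNIV F"
  using convex_on_if_subgradients mean_subgradient by blast

text \<open>The martingale difference of step \<open>j\<close>: for a fixed past \<open>s\<close> its sum over \<open>y\<close> in \<open>{1..n}\<close>
  vanishes.\<close>

definition noise :: "real \<Rightarrow> real \<Rightarrow> 'a \<Rightarrow> 'a \<Rightarrow> nat \<Rightarrow> (nat \<Rightarrow> nat) \<Rightarrow> nat \<Rightarrow> real" where
  "noise \<eta> D v u j s y =
     (let z = psg_iterate g \<eta> D s v j in (mean_gradient z - g y z) \<bullet> (z - u))"

text \<open>The classical argument: as projections do not increase distances, the squared distance to \<open>u\<close>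
  drops in each step by \<open>2 \<eta>\<close> times the directional gradient, up to \<open>\<eta>\<^sup>2 G\<^sup>2\<close>. Telescoping bounds
  the sum of the sampled directional gradients; replacing them by the mean gradients, which dominate
  the gaps in \<open>F\<close>, costs the noise.\<close>

lemma psg_regret:
  assumes D: "D \<ge> 0" and \<eta>: "\<eta> > 0" and u: "u \<in> cball v D"
    and s: "\<And>i. i \<in> {1..m} \<Longrightarrow> s i \<in> {1..n}"
  shows "F (psg_average g \<eta> D (Suc m) s v) - F u
    \<le> D\<^sup>2 / (2 * \<eta> * real (Suc m)) + \<eta> * G\<^sup>2 / 2 + (\<Sum>j<m. noise \<eta> D v u j s (s (Suc j))) / real (Suc m)"
proof -
  define z where "z = psg_iterate g \<eta> D s v"
  define \<gamma> where "\<gamma> j = g (s (Suc j)) (z j) \<bullet> (z j - u)" for j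
  have G2: "(norm (g i w))\<^sup>2 \<le> G\<^sup>2" if "i \<in> {1..n}" for i w
    using bound[OF that] by (intro power_mono) auto
  have expand: "(norm (z j - \<eta> *\<^sub>R e - u))\<^sup>2 = (norm (z j - u))\<^sup>2 - 2 * \<eta> * (e \<bullet> (z j - u)) + \<eta>\<^sup>2 * (norm e)\<^sup>2" for j e
  proof -
    have "(norm ((z j - u) - \<eta> *\<^sub>R e))\<^sup>2 = (norm (z j - u))\<^sup>2 - 2 * \<eta> * (e \<bullet> (z j - u)) + \<eta>\<^sup>2 * (norm e)\<^sup>2"
      unfolding power2_norm_eq_inner inner_diff_left[of "z j - u"] inner_diff_right[of _ "z j - u"]
      by (simp add: inner_commute[of "z j" e] inner_commute[of u e] power2_eq_square algebra_simps)
    then show ?thesis by (simp add: algebra_simps)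
  qed
  have step: "2 * \<eta> * \<gamma> j \<le> (norm (z j - u))\<^sup>2 - (norm (z (Suc j) - u))\<^sup>2 + \<eta>\<^sup>2 * G\<^sup>2" if j: "j < m" for j
  proof -
    let ?g = "g (s (Suc j)) (z j)"
    have "z (Suc j) = closest_point (cball v D) (z j - \<eta> *\<^sub>R ?g)" by (simp add: z_def)
    then have "norm (z (Suc j) - u) \<le> norm (z j - \<eta> *\<^sub>R ?g - u)"
      using closest_point_lipschitz[of "cball v D" "z j - \<eta> *\<^sub>R ?g" u] closest_point_self[OF u] D
      by (simp add: dist_norm)
    then have "(norm (z (Suc j) - u))\<^sup>2 \<le> (norm (z j - \<eta> *\<^sub>R ?g - u))\<^sup>2" by (intro power_mono) auto
    also have "\<dots> \<le> (norm (z j - u))\<^sup>2 - 2 * \<eta> * \<gamma> j + \<eta>\<^sup>2 * G\<^sup>2"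
      unfolding expand \<gamma>_def using G2[OF s, of "Suc j" "z j"] j by (intro add_mono mult_left_mono) auto
    finally show ?thesis by simp
  qed
  have telescope: "2 * \<eta> * (\<Sum>j<k. \<gamma> j) \<le> (norm (v - u))\<^sup>2 - (norm (z k - u))\<^sup>2 + real k * (\<eta>\<^sup>2 * G\<^sup>2)" if "k \<le> m" for k
    using that
  proof (induction k)
    case 0
    then show ?case by (simp add: z_def)
  next
    case (Suc k)
    then show ?case using step[of k] by (simp add: algebra_simps)
  qed
  \<comment> \<open>No sample is drawn at the last iterate: a virtual step along the mean gradient
     bounds its gap without any noise.\<close>
  have last: "2 * \<eta> * (mean_gradient (z m) \<bullet> (z m - u)) \<le> (norm (z m - u))\<^sup>2 + \<eta>\<^sup>2 * G\<^sup>2"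
  proof -
    have "0 \<le> (norm (z m - u))\<^sup>2 - 2 * \<eta> * (mean_gradient (z m) \<bullet> (z m - u)) + \<eta>\<^sup>2 * (norm (mean_gradient (z m)))\<^sup>2"
      unfolding expand[symmetric] by simp
    moreover have "\<eta>\<^sup>2 * (norm (mean_gradient (z m)))\<^sup>2 \<le> \<eta>\<^sup>2 * G\<^sup>2"
      using norm_mean_gradient by (intro mult_left_mono power_mono) auto
    ultimately show ?thesis by linarith
  qed
  have gap: "F (z j) - F u \<le> mean_gradient (z j) \<bullet> (z j - u)" for j
    using mean_subgradient[of "z j"] unfolding is_subgradient_def
    by (smt (verit) inner_minus_right minus_diff_eq)
  let ?N = "\<Sum>j<m. noise \<eta> D v u j s (s (Suc j))"
  have "(\<Sum>j<Suc m. F (z j) - F u) \<le> (\<Sum>j<Suc m. mean_gradient (z j) \<bullet> (z j - u))"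
    by (intro sum_mono gap)
  also have "\<dots> = (\<Sum>j<m. \<gamma> j) + ?N + mean_gradient (z m) \<bullet> (z m - u)"
    by (simp add: noise_def Let_def z_def[symmetric] \<gamma>_def inner_diff_left sum_subtractf)
  finally have sum_gap: "(\<Sum>j<Suc m. F (z j) - F u) \<le> (\<Sum>j<m. \<gamma> j) + ?N + mean_gradient (z m) \<bullet> (z m - u)" .
  have "norm (v - u) \<le> D" using u by (simp add: dist_norm)
  then have "(norm (v - u))\<^sup>2 \<le> D\<^sup>2" by (intro power_mono) auto
  then have "2 * \<eta> * ((\<Sum>j<m. \<gamma> j) + mean_gradient (z m) \<bullet> (z m - u)) \<le> D\<^sup>2 + real (Suc m) * (\<eta>\<^sup>2 * G\<^sup>2)"
    using telescope[of m] last by (simp add: algebra_simps)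
  then have "(\<Sum>j<m. \<gamma> j) + mean_gradient (z m) \<bullet> (z m - u) \<le> (D\<^sup>2 + real (Suc m) * (\<eta>\<^sup>2 * G\<^sup>2)) / (2 * \<eta>)"
    using \<eta> by (simp add: pos_le_divide_eq mult.commute)
  with sum_gap have total: "(\<Sum>j<Suc m. F (z j) - F u) \<le> (D\<^sup>2 + real (Suc m) * (\<eta>\<^sup>2 * G\<^sup>2)) / (2 * \<eta>) + ?N"
    by linarith
  define w where "w = psg_average g \<eta> D (Suc m) s v"
  have w: "real (Suc m) *\<^sub>R w = (\<Sum>j<Suc m. z j)" by (simp add: w_def psg_average_def z_def)
  have "(\<Sum>j<Suc m. F w + mean_gradient w \<bullet> (z j - w)) \<le> (\<Sum>j<Suc m. F (z j))"
    using mean_subgradient[of w] by (intro sum_mono) (simp add: is_subgradient_def)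
  moreover have "(\<Sum>j<Suc m. mean_gradient w \<bullet> (z j - w)) = 0"
  proof -
    have "(\<Sum>j<Suc m. mean_gradient w \<bullet> (z j - w)) = mean_gradient w \<bullet> ((\<Sum>j<Suc m. z j) - real (Suc m) *\<^sub>R w)"
      by (simp only: inner_sum_right[symmetric] sum_subtractf sum_constant_scaleR card_lessThan)
    then show ?thesis by (simp only: w diff_self inner_zero_right)
  qed
  ultimately have "real (Suc m) * F w \<le> (\<Sum>j<Suc m. F (z j))"
    by (simp only: sum.distrib sum_constant card_lessThan add_0_right)
  then have "real (Suc m) * (F w - F u) \<le> (\<Sum>j<Suc m. F (z j) - F u)"
    by (simp only: sum_subtractf sum_constant card_lessThan right_diff_distrib)
  with total have "F w - F u \<le> ((D\<^sup>2 + real (Suc m) * (\<eta>\<^sup>2 * G\<^sup>2)) / (2 * \<eta>) + ?N) / real (Suc m)"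
    by (simp add: pos_le_divide_eq mult.commute)
  also have "\<dots> = D\<^sup>2 / (2 * \<eta> * real (Suc m)) + \<eta> * G\<^sup>2 / 2 + ?N / real (Suc m)"
    using \<eta> by (simp add: field_simps power2_eq_square del: of_nat_Suc)
  finally show ?thesis by (simp add: w_def)
qed

text \<open>The step size and the number of iterates are chosen such that each of the three error terms in
  the regret bound has a share of \<open>E / 6\<close>: the step size term is equal to it, the factor 9 takes care of
  the initial distance, and the factor 1728 makes the noise, whose increments are at most \<open>4 G D\<close> because
  both \<open>u\<close> and the iterates lie in the ball, exceed its share with probability at most \<open>\<delta>\<close>.\<close>

lemma stage_bound:
  assumes E: "E > 0" and D: "D > 0" and \<delta>: "0 < \<delta>" "\<delta> \<le> 1" and u: "u \<in> cball v D"
    and t1: "t \<ge> 1" and t: "real t \<ge> max 9 (1728 * ln (1 / \<delta>)) * G\<^sup>2 * D\<^sup>2 / E\<^sup>2"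
  shows "measure_pmf.prob (samples n {1..<t})
           {s. F (psg_average g (E / (3 * G\<^sup>2)) D t s v) - F u > E / 2} \<le> \<delta>"
proof -
  obtain m where m: "t = Suc m" using t1 by (cases t) auto
  define \<eta> where "\<eta> = E / (3 * G\<^sup>2)"
  have \<eta>: "\<eta> > 0" using E G by (simp add: \<eta>_def)
  have tpos: "real t > 0" using t1 by simp
  define B where "B = 4 * G * D"
  have B: "B > 0" using G D by (simp add: B_def)
  let ?X = "noise \<eta> D v u"
  let ?p = "samples n {1..m}"
  have I: "{1..<t} = {1..m}" by (auto simp: m)
  have c9: "9 * G\<^sup>2 * D\<^sup>2 \<le> real t * E\<^sup>2" and cln: "1728 * ln (1 / \<delta>) * G\<^sup>2 * D\<^sup>2 \<le> real t * E\<^sup>2"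
  proof -
    have "max 9 (1728 * ln (1 / \<delta>)) * (G\<^sup>2 * D\<^sup>2) \<le> real t * E\<^sup>2"
      using t E by (simp add: pos_divide_le_eq mult.assoc)
    moreover have "9 * (G\<^sup>2 * D\<^sup>2) \<le> max 9 (1728 * ln (1 / \<delta>)) * (G\<^sup>2 * D\<^sup>2)"
      "1728 * ln (1 / \<delta>) * (G\<^sup>2 * D\<^sup>2) \<le> max 9 (1728 * ln (1 / \<delta>)) * (G\<^sup>2 * D\<^sup>2)"
      by (intro mult_right_mono; simp)+
    ultimately show "9 * G\<^sup>2 * D\<^sup>2 \<le> real t * E\<^sup>2" "1728 * ln (1 / \<delta>) * G\<^sup>2 * D\<^sup>2 \<le> real t * E\<^sup>2"
      by (simp_all add: mult.assoc)
  qed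
  have "measure_pmf.prob ?p {s. F (psg_average g \<eta> D t s v) - F u > E / 2}
    \<le> measure_pmf.prob ?p {s. real t * E / 6 \<le> (\<Sum>j<m. ?X j s (s (Suc j)))}"
  proof (rule measure_pmf.finite_measure_mono_AE)
    show "AE s in measure_pmf ?p. s \<in> {s. F (psg_average g \<eta> D t s v) - F u > E / 2} \<longrightarrow>
        s \<in> {s. real t * E / 6 \<le> (\<Sum>j<m. ?X j s (s (Suc j)))}"
      unfolding AE_measure_pmf_iff
    proof (intro ballI impI CollectI)
      fix s assume s: "s \<in> set_pmf ?p" and "s \<in> {s. F (psg_average g \<eta> D t s v) - F u > E / 2}"
      then have big: "E / 2 < F (psg_average g \<eta> D t s v) - F u" by simp
      have "\<And>i. i \<in> {1..m} \<Longrightarrow> s i \<in> {1..n}" using set_samples[OF n _ s] by blast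
      then have "F (psg_average g \<eta> D t s v) - F u
        \<le> D\<^sup>2 / (2 * \<eta> * real t) + \<eta> * G\<^sup>2 / 2 + (\<Sum>j<m. ?X j s (s (Suc j))) / real t"
        unfolding m using psg_regret[OF _ \<eta> u, of m s] D by simp
      moreover have "\<eta> * G\<^sup>2 / 2 = E / 6" using G by (simp add: \<eta>_def)
      moreover have "D\<^sup>2 / (2 * \<eta> * real t) \<le> E / 6"
      proof -
        have "D\<^sup>2 / (2 * \<eta> * real t) = 9 * G\<^sup>2 * D\<^sup>2 / (6 * E * real t)"
          using E G tpos by (simp add: \<eta>_def field_simps)
        also have "\<dots> \<le> real t * E\<^sup>2 / (6 * E * real t)"
          using c9 E tpos by (intro divide_right_mono) auto
        also have "\<dots> = E / 6" using E tpos by (simp add: power2_eq_square)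
        finally show ?thesis .
      qed
      ultimately have "E / 6 \<le> (\<Sum>j<m. ?X j s (s (Suc j))) / real t" using big by linarith
      then show "real t * E / 6 \<le> (\<Sum>j<m. ?X j s (s (Suc j)))"
        using tpos by (simp add: pos_le_divide_eq mult.commute)
    qed
  qed simp
  also have "\<dots> \<le> exp (- ((real t * E / 6)\<^sup>2 / (2 * real t * B\<^sup>2)))"
  proof (rule azuma_hoeffding_uniform[OF n])
    show "?X j s = ?X j s'" if "\<And>i. i \<in> {1..j} \<Longrightarrow> s i = s' i" for j s s'
    proof -
      have "psg_iterate g \<eta> D s v j = psg_iterate g \<eta> D s' v j" by (rule psg_iterate_cong) (rule that)
      then show ?thesis by (intro ext) (simp only: noise_def)
    qed
    show "(\<Sum>y=1..n. ?X j s y) = 0" for j s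
    proof -
      let ?z = "psg_iterate g \<eta> D s v j"
      have "(\<Sum>y=1..n. ?X j s y) = (real n *\<^sub>R mean_gradient ?z - (\<Sum>y=1..n. g y ?z)) \<bullet> (?z - u)"
        by (simp add: noise_def Let_def inner_sum_left[symmetric] sum_subtractf sum_constant_scaleR)
      also have "real n *\<^sub>R mean_gradient ?z = (\<Sum>y=1..n. g y ?z)" using n by (simp add: mean_gradient_def)
      finally show ?thesis by simp
    qed
    show "\<bar>?X j s y\<bar> \<le> B" if y: "y \<in> {1..n}" for j s y
    proof -
      let ?z = "psg_iterate g \<eta> D s v j"
      have "\<bar>?X j s y\<bar> \<le> norm (mean_gradient ?z - g y ?z) * norm (?z - u)"
        unfolding noise_def Let_def by (rule Cauchy_Schwarz_ineq2)
      also have "\<dots> \<le> (G + G) * (D + D)"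
      proof (intro mult_mono)
        show "norm (mean_gradient ?z - g y ?z) \<le> G + G"
          using norm_triangle_ineq4[of "mean_gradient ?z" "g y ?z"] norm_mean_gradient[of ?z] bound[OF y, of ?z] by linarith
        have "dist v ?z \<le> D" using psg_iterate_in_ball[of D g \<eta> s v j] D by simp
        moreover have "dist v u \<le> D" using u by simp
        ultimately show "norm (?z - u) \<le> D + D"
          using dist_triangle[of ?z u v] by (simp add: dist_commute dist_norm[symmetric])
      qed (use G D in auto)
      finally show ?thesis by (simp add: B_def)
    qed
    show "real t * E / 6 > 0" "real m \<le> real t" "real t > 0" using tpos E m by auto
  qed (rule B)
  also have "\<dots> \<le> exp (- ln (1 / \<delta>))"
  proof -
    have L: "ln (1 / \<delta>) \<ge> 0" using \<delta> by simp
    have "ln (1 / \<delta>) * (1152 * G\<^sup>2 * D\<^sup>2) \<le> ln (1 / \<delta>) * (1728 * G\<^sup>2 * D\<^sup>2)"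
      using L by (intro mult_left_mono) auto
    also have "\<dots> \<le> real t * E\<^sup>2" using cln by (simp add: mult_ac)
    finally have "ln (1 / \<delta>) \<le> real t * E\<^sup>2 / (1152 * G\<^sup>2 * D\<^sup>2)"
      using G D by (simp add: pos_le_divide_eq)
    also have "\<dots> = (real t * E / 6)\<^sup>2 / (2 * real t * B\<^sup>2)"
      using tpos G D by (simp add: B_def field_simps power2_eq_square)
    finally show ?thesis by simp
  qed
  also have "\<dots> = \<delta>" using \<delta> by (simp add: ln_div)
  finally show ?thesis unfolding I \<eta>_def .
qed

end

section \<open>The restarted method\<close>

lemma emeasure_pair_pmf:
  "emeasure (measure_pmf (pair_pmf p q)) S = (\<integral>\<^sup>+a. emeasure (measure_pmf q) {b. (a, b) \<in> S} \<partial>measure_pmf p)"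
proof -
  have "emeasure (measure_pmf (pair_pmf p q)) S = (\<integral>\<^sup>+x. indicator S x \<partial>measure_pmf (pair_pmf p q))" by simp
  also have "\<dots> = (\<integral>\<^sup>+a. \<integral>\<^sup>+b. indicator {b. (a, b) \<in> S} b \<partial>measure_pmf q \<partial>measure_pmf p)"
    unfolding nn_integral_pair_pmf' by (intro nn_integral_cong) (simp add: indicator_def)
  finally show ?thesis by simp
qed

text \<open>Conditioning on the first component, with the trivial bound 1 where it lies in \<open>A\<close>.\<close>

lemma prob_pair_pmf_le:
  assumes "\<And>a. a \<notin> A \<Longrightarrow> measure_pmf.prob q {b. (a, b) \<in> S} \<le> \<delta>" and \<delta>: "\<delta> \<ge> 0"
  shows "measure_pmf.prob (pair_pmf p q) S \<le> measure_pmf.prob p A + \<delta>"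
proof -
  have "emeasure (measure_pmf (pair_pmf p q)) S \<le> (\<integral>\<^sup>+a. indicator A a + ennreal \<delta> \<partial>measure_pmf p)"
    unfolding emeasure_pair_pmf
  proof (intro nn_integral_mono)
    fix a
    show "emeasure (measure_pmf q) {b. (a, b) \<in> S} \<le> indicator A a + ennreal \<delta>"
    proof (cases "a \<in> A")
      case True
      have "emeasure (measure_pmf q) {b. (a, b) \<in> S} \<le> 1" by (rule measure_pmf.emeasure_le_1)
      also have "\<dots> \<le> indicator A a + ennreal \<delta>" using True by simp
      finally show ?thesis .
    next
      case False
      then show ?thesis
        using assms(1)[OF False] by (simp add: measure_pmf.emeasure_eq_measure ennreal_leI)
    qed
  qed
  also have "\<dots> = emeasure (measure_pmf p) A + ennreal \<delta>"
    by (subst nn_integral_add) (auto simp: measure_pmf.emeasure_space_1[simplified])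
  finally show ?thesis
    using \<delta> by (simp add: measure_pmf.emeasure_eq_measure ennreal_plus[symmetric] del: ennreal_plus)
qed

text \<open>Going from \<open>v\<close> towards its projection onto the minimizers, one reaches level \<open>\<epsilon>\<close> at a point \<open>u\<close>.
  Growth bounds the remaining distance by \<open>c \<surd>\<epsilon>\<close>, over which the value drops by \<open>\<epsilon>\<close>; by convexity
  the average slope before \<open>u\<close> is at least that large, so the distance travelled is at most
  \<open>c / \<surd>\<epsilon>\<close> times the total drop, which is at most \<open>E\<close>. This is why the radius of the balls may shrink with the accuracy.\<close>

lemma comparator_in_ball:
  fixes F :: "'a::euclidean_space \<Rightarrow> real"
  assumes F: "convex_on UNIV F" and ne: "minimizers F \<noteq> {}"
    and lg: "local_growth F (1/2) c \<epsilon>" and \<epsilon>: "\<epsilon> > 0" and c: "c > 0" and E: "E > 0"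
    and v: "F v - min_value F \<le> E + \<epsilon>"
  shows "\<exists>u\<in>cball v (c * E / sqrt \<epsilon>). F u - min_value F \<le> \<epsilon>"
proof (cases "F v - min_value F \<le> \<epsilon>")
  case True
  then show ?thesis using c E \<epsilon> by (intro bexI[of _ v]) auto
next
  case False
  let ?p = "closest_point (minimizers F) v"
  obtain u where u: "F u - min_value F = \<epsilon>" "closest_point (minimizers F) u = ?p"
    "norm (v - ?p) = norm (v - u) + norm (u - ?p)"
    "norm (v - ?p) * \<epsilon> \<le> norm (u - ?p) * (F v - min_value F)"
    using point_towards_minimizer[OF F ne \<epsilon>, of v] False by (metis linear)
  have "norm (u - ?p) \<le> c * (F u - min_value F) powr (1/2)"
    using lg u(1,2) unfolding local_growth_def sublevel_def by force
  then have up: "norm (u - ?p) \<le> c * sqrt \<epsilon>" using u(1) \<epsilon> by (simp add: powr_half_sqrt)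
  have "norm (v - u) * \<epsilon> \<le> norm (u - ?p) * (F v - min_value F - \<epsilon>)"
    using u(3,4) by (simp add: algebra_simps)
  also have "\<dots> \<le> (c * sqrt \<epsilon>) * E"
    using up v False c \<epsilon> by (intro mult_mono) auto
  finally have "norm (v - u) \<le> (c * sqrt \<epsilon>) * E / \<epsilon>" using \<epsilon> by (simp add: pos_le_divide_eq)
  also have "\<dots> = c * E / sqrt \<epsilon>"
    using \<epsilon> by (simp add: field_simps)
  finally show ?thesis using u(1) by (intro bexI[of _ u]) (auto simp: dist_norm)
qed

context bounded_subgradient_average
begin

text \<open>If the first \<open>k\<close> stages succeed, the ball of the next stage contains an \<open>\<epsilon>\<close>-optimal comparison
  point, and that stage fails to halve \<open>\<epsilon>\<^sub>0 / 2 ^ k\<close> with probability at most \<open>\<delta>\<close>, whatever the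
  earlier samples were, because its own samples are independent of them.\<close>

lemma assg_failure_bound:
  assumes ne: "minimizers F \<noteq> {}" and lg: "local_growth F (1/2) c \<epsilon>"
    and \<epsilon>: "\<epsilon> > 0" and c: "c > 0" and \<epsilon>0: "\<epsilon>\<^sub>0 > 0" and w0: "F w\<^sub>0 - min_value F \<le> \<epsilon>\<^sub>0"
    and \<delta>: "0 < \<delta>" "\<delta> \<le> 1" and D1: "D1 = c * \<epsilon>\<^sub>0 / sqrt \<epsilon>"
    and t1: "t \<ge> 1" and t: "real t \<ge> max 9 (1728 * ln (1 / \<delta>)) * G\<^sup>2 * D1\<^sup>2 / \<epsilon>\<^sub>0\<^sup>2"
  shows "measure_pmf.prob (samples n ({1..k} \<times> {1..<t}))
     {s. F (assg_stage g (\<epsilon>\<^sub>0 / (3 * G\<^sup>2)) D1 t (\<lambda>k \<tau>. s (k, \<tau>)) w\<^sub>0 k) - min_value F > \<epsilon>\<^sub>0 / 2 ^ k + \<epsilon>}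
    \<le> real k * \<delta>"
proof (induction k)
  case 0
  have "\<not> \<epsilon>\<^sub>0 + \<epsilon> < F w\<^sub>0 - min_value F" using w0 \<epsilon> by linarith
  then show ?case by simp
next
  case (Suc k)
  define W where "W k s = assg_stage g (\<epsilon>\<^sub>0 / (3 * G\<^sup>2)) D1 t (\<lambda>k \<tau>. s (k, \<tau>)) w\<^sub>0 k" for k s
  define bad where "bad k = {s. F (W k s) - min_value F > \<epsilon>\<^sub>0 / 2 ^ k + \<epsilon>}" for k
  let ?A = "{1..k} \<times> {1..<t}" and ?B = "{Suc k} \<times> {1..<t}"
  define E where "E = \<epsilon>\<^sub>0 / 2 ^ k"
  define D where "D = D1 / 2 ^ k"
  have E: "E > 0" using \<epsilon>0 by (simp add: E_def)
  have D: "D = c * E / sqrt \<epsilon>" by (simp add: D_def E_def D1)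
  have Dpos: "D > 0" using D E c \<epsilon> by simp
  have ratio: "D\<^sup>2 / E\<^sup>2 = D1\<^sup>2 / \<epsilon>\<^sub>0\<^sup>2" by (simp add: D_def E_def power_divide)
  have tE: "real t \<ge> max 9 (1728 * ln (1 / \<delta>)) * G\<^sup>2 * D\<^sup>2 / E\<^sup>2"
    using t ratio by (metis times_divide_eq_right)
  \<comment> \<open>\<open>a\<close> holds the samples of the earlier stages, \<open>b\<close> those of the new one.\<close>
  define h where "h = (\<lambda>(a :: nat \<times> nat \<Rightarrow> nat, b :: nat \<times> nat \<Rightarrow> nat) x. if x \<in> ?A then a x else b x)"
  have W_old: "W k (h (a, b)) = W k a" for a b
    unfolding W_def by (rule assg_stage_cong) (auto simp: h_def)
  have W_new: "W (Suc k) (h (a, b)) = psg_average g (E / (3 * G\<^sup>2)) D t (\<lambda>\<tau>. b (Suc k, \<tau>)) (W k a)" for a b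
  proof -
    have "W (Suc k) (h (a, b)) = psg_average g (E / (3 * G\<^sup>2)) D t (\<lambda>\<tau>. h (a, b) (Suc k, \<tau>)) (W k (h (a, b)))"
    proof -
      have "\<epsilon>\<^sub>0 / (3 * G\<^sup>2) / 2 ^ k = E / (3 * G\<^sup>2)" by (simp add: E_def mult.commute)
      then show ?thesis by (simp only: W_def assg_stage.simps D_def)
    qed
    also have "\<dots> = psg_average g (E / (3 * G\<^sup>2)) D t (\<lambda>\<tau>. b (Suc k, \<tau>)) (W k a)"
      unfolding W_old by (rule psg_average_cong) (simp add: h_def)
    finally show ?thesis .
  qed
  have cond: "measure_pmf.prob (samples n ?B) {b. (a, b) \<in> h -` bad (Suc k)} \<le> \<delta>" if a: "a \<notin> bad k" for a
  proof -
    have "F (W k a) - min_value F \<le> E + \<epsilon>" using a by (simp add: bad_def E_def)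
    then obtain u where u: "u \<in> cball (W k a) D" "F u - min_value F \<le> \<epsilon>"
      unfolding D using comparator_in_ball[OF convex_objective ne lg \<epsilon> c E] by blast
    have "measure_pmf.prob (samples n ?B) {b. (a, b) \<in> h -` bad (Suc k)}
      \<le> measure_pmf.prob (samples n ?B) {b. F (psg_average g (E / (3 * G\<^sup>2)) D t (b \<circ> Pair (Suc k)) (W k a)) - F u > E / 2}"
    proof (rule measure_pmf.finite_measure_mono)
      show "{b. (a, b) \<in> h -` bad (Suc k)} \<subseteq> {b. F (psg_average g (E / (3 * G\<^sup>2)) D t (b \<circ> Pair (Suc k)) (W k a)) - F u > E / 2}"
        using u(2) by (auto simp: bad_def W_new E_def o_def)
    qed simp
    also have "\<dots> = measure_pmf.prob (samples n {1..<t}) {s. F (psg_average g (E / (3 * G\<^sup>2)) D t s (W k a)) - F u > E / 2}"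
    proof -
      have "bij_betw (Pair (Suc k)) {1..<t} ?B" by (auto simp: bij_betw_def inj_on_def)
      then have "samples n {1..<t} = map_pmf (\<lambda>b. b \<circ> Pair (Suc k)) (samples n ?B)"
        by (intro Pi_pmf_bij_betw) auto
      then show ?thesis by (simp add: vimage_def)
    qed
    also have "\<dots> \<le> \<delta>" by (rule stage_bound[OF E Dpos \<delta> u(1) t1 tE])
    finally show ?thesis .
  qed
  have "{1..Suc k} \<times> {1..<t} = ?A \<union> ?B" by auto
  moreover have "samples n (?A \<union> ?B) = map_pmf h (pair_pmf (samples n ?A) (samples n ?B))"
    unfolding h_def by (rule Pi_pmf_union) auto
  ultimately have "measure_pmf.prob (samples n ({1..Suc k} \<times> {1..<t})) (bad (Suc k))
    = measure_pmf.prob (pair_pmf (samples n ?A) (samples n ?B)) (h -` bad (Suc k))" by simp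
  also have "\<dots> \<le> measure_pmf.prob (samples n ?A) (bad k) + \<delta>"
    by (rule prob_pair_pmf_le[OF cond]) (use \<delta> in auto)
  also have "\<dots> \<le> real (Suc k) * \<delta>" using Suc by (simp add: bad_def W_def algebra_simps)
  finally show ?case by (simp add: bad_def W_def)
qed

end

text \<open>Independence and uniformity determine the probability of each assignment of values in \<open>{1..n}\<close> to
  the variables in \<open>I\<close>, and these finitely many disjoint events carry the law of the samples. An
  inequality suffices; it avoids the null set on which some variable leaves \<open>{1..n}\<close>.\<close>

lemma prob_samples_le:
  fixes X :: "'i \<Rightarrow> 'p \<Rightarrow> nat"
  assumes M: "prob_space M" and fin: "finite I" and n: "n \<ge> 1"
    and indep: "prob_space.indep_vars M (\<lambda>_. count_space UNIV) X I"
    and distr: "\<And>i. i \<in> I \<Longrightarrow> distr M (count_space UNIV) (X i) = measure_pmf (pmf_of_set {1..n})"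
    and Q: "\<And>s s'. (\<And>i. i \<in> I \<Longrightarrow> s i = s' i) \<Longrightarrow> Q s = Q s'"
  shows "measure_pmf.prob (samples n I) {s. Q s} \<le> measure M {\<omega> \<in> space M. Q (\<lambda>i. X i \<omega>)}"
proof -
  interpret prob_space M by (rule M)
  have X: "X i \<in> measurable M (count_space UNIV)" if "i \<in> I" for i
    using indep that by (auto simp: indep_vars_def)
  have "(\<lambda>\<omega>. \<lambda>i\<in>I. X i \<omega>) \<in> measurable M (PiM I (\<lambda>_. count_space UNIV))"
    by (rule measurable_restrict) (rule X)
  also have "PiM I (\<lambda>_. count_space (UNIV :: nat set)) = count_space (PiE I (\<lambda>_. UNIV))"
    by (rule count_space_PiM_finite) (use fin in auto)
  finally have meas: "(\<lambda>\<omega>. \<lambda>i\<in>I. X i \<omega>) \<in> measurable M (count_space (PiE I (\<lambda>_. UNIV)))" .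
  have event: "{\<omega> \<in> space M. P (\<lambda>i\<in>I. X i \<omega>)} \<in> sets M" for P
  proof -
    have "{\<omega> \<in> space M. P (\<lambda>i\<in>I. X i \<omega>)} = (\<lambda>\<omega>. \<lambda>i\<in>I. X i \<omega>) -` (PiE I (\<lambda>_. UNIV) \<inter> {s. P s}) \<inter> space M"
      by auto
    also have "\<dots> \<in> sets M" by (rule measurable_sets[OF meas]) simp
    finally show ?thesis .
  qed
  have QX: "Q (\<lambda>i. X i \<omega>) = Q (\<lambda>i\<in>I. X i \<omega>)" for \<omega> by (rule Q) simp
  define atom where "atom s = {\<omega> \<in> space M. \<forall>i\<in>I. X i \<omega> = s i}" for s
  have atom_sets: "atom s \<in> sets M" for s
    using event[of "\<lambda>r. \<forall>i\<in>I. r i = s i"] by (simp add: atom_def)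
  define S where "S = PiE_dflt I 0 (\<lambda>_. {1..n})"
  have finS: "finite S" unfolding S_def using fin by (intro finite_PiE_dflt) auto
  have ne: "{1..n} \<noteq> {}" "finite {1..n}" using n by auto
  have setS: "set_pmf (samples n I) = S"
    unfolding S_def using ne by (subst set_Pi_pmf[OF fin]) (simp add: PiE_dflt_def o_def)
  have prob_atom: "prob (atom s) = pmf (samples n I) s" if s: "s \<in> S" for s
  proof -
    have "prob (atom s) = (\<Prod>i\<in>I. pmf (pmf_of_set {1..n}) (s i))"
    proof (cases "I = {}")
      case True
      then show ?thesis by (simp add: atom_def prob_space)
    next
      case False
      have "atom s = (\<Inter>i\<in>I. X i -` {s i} \<inter> space M)" using False by (auto simp: atom_def)
      then have "prob (atom s) = (\<Prod>i\<in>I. prob (X i -` {s i} \<inter> space M))"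
        using indep_varsD_finite[OF indep False fin, of "\<lambda>i. {s i}"] by simp
      also have "\<dots> = (\<Prod>i\<in>I. pmf (pmf_of_set {1..n}) (s i))"
      proof (rule prod.cong[OF refl])
        fix i assume i: "i \<in> I"
        have "prob (X i -` {s i} \<inter> space M) = measure (distr M (count_space UNIV) (X i)) {s i}"
          by (rule measure_distr[OF X[OF i], symmetric]) simp
        then show "prob (X i -` {s i} \<inter> space M) = pmf (pmf_of_set {1..n}) (s i)"
          by (simp only: distr[OF i] measure_pmf_single)
      qed
      finally show ?thesis .
    qed
    also have "\<dots> = pmf (samples n I) s" using s by (simp add: pmf_Pi[OF fin] S_def PiE_dflt_def)
    finally show ?thesis .
  qed
  define T where "T = S \<inter> {s. Q s}"
  have "measure_pmf.prob (samples n I) {s. Q s} = measure_pmf.prob (samples n I) T"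
    unfolding T_def setS[symmetric] by (metis Int_commute measure_Int_set_pmf)
  also have "\<dots> = (\<Sum>s\<in>T. pmf (samples n I) s)"
    using finS by (intro measure_measure_pmf_finite) (simp add: T_def)
  also have "\<dots> = (\<Sum>s\<in>T. prob (atom s))" using prob_atom by (simp add: T_def)
  also have "\<dots> = prob (\<Union>s\<in>T. atom s)"
  proof (rule finite_measure_finite_Union[symmetric])
    show "disjoint_family_on atom T"
      unfolding disjoint_family_on_def
    proof (intro ballI impI equals0I)
      fix s s' \<omega> assume ss: "s \<in> T" "s' \<in> T" "s \<noteq> s'" "\<omega> \<in> atom s \<inter> atom s'"
      have "s i = s' i" for i
        using ss by (cases "i \<in> I") (auto simp: atom_def T_def S_def PiE_dflt_def)
      then show False using ss(3) by blast
    qed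
  qed (use finS atom_sets in \<open>auto simp: T_def\<close>)
  also have "\<dots> \<le> prob {\<omega> \<in> space M. Q (\<lambda>i. X i \<omega>)}"
  proof (rule finite_measure_mono)
    show "(\<Union>s\<in>T. atom s) \<subseteq> {\<omega> \<in> space M. Q (\<lambda>i. X i \<omega>)}"
    proof
      fix \<omega> assume "\<omega> \<in> (\<Union>s\<in>T. atom s)"
      then obtain s where s: "Q s" "\<omega> \<in> space M" "\<And>i. i \<in> I \<Longrightarrow> X i \<omega> = s i"
        by (auto simp: T_def atom_def)
      then show "\<omega> \<in> {\<omega> \<in> space M. Q (\<lambda>i. X i \<omega>)}" using Q[of "\<lambda>i. X i \<omega>" s] by simp
    qed
    show "{\<omega> \<in> space M. Q (\<lambda>i. X i \<omega>)} \<in> events" unfolding QX by (rule event)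
  qed
  finally show "measure_pmf.prob (samples n I) {s. Q s} \<le> prob {\<omega> \<in> space M. Q (\<lambda>i. X i \<omega>)}" .
qed

lemma assg_K_ge_1:
  assumes "0 < \<epsilon>" "\<epsilon> < \<epsilon>\<^sub>0"
  shows "assg_K \<epsilon>\<^sub>0 \<epsilon> \<ge> 1"
proof -
  have "log 2 (\<epsilon>\<^sub>0 / \<epsilon>) > 0" using assms by simp
  then have "\<lceil>log 2 (\<epsilon>\<^sub>0 / \<epsilon>)\<rceil> > 0" by simp
  then show ?thesis unfolding assg_K_def by linarith
qed

lemma final_accuracy:
  assumes "0 < \<epsilon>" "\<epsilon> < \<epsilon>\<^sub>0"
  shows "\<epsilon>\<^sub>0 / 2 ^ assg_K \<epsilon>\<^sub>0 \<epsilon> \<le> \<epsilon>"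
proof -
  have "log 2 (\<epsilon>\<^sub>0 / \<epsilon>) \<le> real (assg_K \<epsilon>\<^sub>0 \<epsilon>)"
    unfolding assg_K_def by (rule real_nat_ceiling_ge)
  then have "\<epsilon>\<^sub>0 / \<epsilon> \<le> 2 powr real (assg_K \<epsilon>\<^sub>0 \<epsilon>)"
    using assms by (simp add: log_le_iff)
  then have "\<epsilon>\<^sub>0 / \<epsilon> \<le> 2 ^ assg_K \<epsilon>\<^sub>0 \<epsilon>" by (simp add: powr_realpow)
  then show ?thesis using assms by (simp add: field_simps)
qed

lemma assg_D1_half:
  assumes "\<epsilon> > 0"
  shows "assg_D1 (1/2) c \<epsilon>\<^sub>0 \<epsilon> = c * \<epsilon>\<^sub>0 / sqrt \<epsilon>"
  using assms by (simp add: assg_D1_def powr_half_sqrt)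

text \<open>A union bound over the \<open>K\<close> stages, each of which fails with probability at most \<open>\<delta> / K\<close>; after
  the last one, the gap is at most \<open>\<epsilon>\<^sub>0 / 2 ^ K + \<epsilon> \<le> 2 \<epsilon>\<close>.\<close>

lemma (in bounded_subgradient_average) assg_high_probability:
  fixes \<xi> :: "nat \<Rightarrow> nat \<Rightarrow> 'p \<Rightarrow> nat"
  assumes ne: "minimizers F \<noteq> {}" and lg: "local_growth F (1/2) c \<epsilon>" and c: "c > 0"
    and \<epsilon>: "0 < \<epsilon>" "\<epsilon> < \<epsilon>\<^sub>0" and \<delta>: "0 < \<delta>" "\<delta> < 1" and w0: "F w\<^sub>0 - min_value F \<le> \<epsilon>\<^sub>0"
    and iid: "iid_uniform_samples M n \<xi> ({1..assg_K \<epsilon>\<^sub>0 \<epsilon>} \<times> {1..<assg_t (1/2) c G \<epsilon>\<^sub>0 \<epsilon> \<delta>})"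
  shows "measure M {\<omega> \<in> space M.
      F (assg_output g (1/2) c G \<epsilon>\<^sub>0 \<epsilon> \<delta> (\<lambda>k \<tau>. \<xi> k \<tau> \<omega>) w\<^sub>0) - min_value F \<le> 2 * \<epsilon>} \<ge> 1 - \<delta>"
proof -
  define K where "K = assg_K \<epsilon>\<^sub>0 \<epsilon>"
  define t where "t = assg_t (1/2) c G \<epsilon>\<^sub>0 \<epsilon> \<delta>"
  define D1 where "D1 = assg_D1 (1/2) c \<epsilon>\<^sub>0 \<epsilon>"
  define \<delta>' where "\<delta>' = \<delta> / real K"
  have K: "K \<ge> 1" unfolding K_def using assg_K_ge_1[OF \<epsilon>] .
  have \<delta>': "0 < \<delta>'" "\<delta>' \<le> 1" using \<delta> K by (auto simp: \<delta>'_def field_simps)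
  have \<epsilon>0: "\<epsilon>\<^sub>0 > 0" using \<epsilon> by simp
  have D1: "D1 = c * \<epsilon>\<^sub>0 / sqrt \<epsilon>" unfolding D1_def using assg_D1_half[OF \<epsilon>(1)] .
  have t_def': "t = nat \<lceil>max 9 (1728 * ln (1 / \<delta>')) * G\<^sup>2 * D1\<^sup>2 / \<epsilon>\<^sub>0\<^sup>2\<rceil>"
    by (simp add: t_def assg_t_def \<delta>'_def D1_def K_def)
  have t: "real t \<ge> max 9 (1728 * ln (1 / \<delta>')) * G\<^sup>2 * D1\<^sup>2 / \<epsilon>\<^sub>0\<^sup>2"
    unfolding t_def' by (rule real_nat_ceiling_ge)
  have "max 9 (1728 * ln (1 / \<delta>')) * G\<^sup>2 * D1\<^sup>2 / \<epsilon>\<^sub>0\<^sup>2 > 0"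
    using G c \<epsilon>0 \<epsilon>(1) by (simp add: D1 less_max_iff_disj)
  then have "real t > 0" using t by linarith
  then have t1: "t \<ge> 1" by simp
  let ?out = "\<lambda>s. assg_stage g (\<epsilon>\<^sub>0 / (3 * G\<^sup>2)) D1 t (\<lambda>k \<tau>. s (k, \<tau>)) w\<^sub>0 K"
  define Q where "Q s \<longleftrightarrow> F (?out s) - min_value F \<le> 2 * \<epsilon>" for s :: "nat \<times> nat \<Rightarrow> nat"
  let ?I = "{1..K} \<times> {1..<t}"
  have M: "prob_space M"
    and indep: "prob_space.indep_vars M (\<lambda>_. count_space UNIV) (\<lambda>(k, \<tau>). \<xi> k \<tau>) ?I"
    and distr: "\<And>i. i \<in> ?I \<Longrightarrow> distr M (count_space UNIV) ((\<lambda>(k, \<tau>). \<xi> k \<tau>) i) = measure_pmf (pmf_of_set {1..n})"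
    using iid unfolding iid_uniform_samples_def K_def t_def by (auto split: prod.splits)
  have Qcong: "Q s = Q s'" if "\<And>i. i \<in> ?I \<Longrightarrow> s i = s' i" for s s'
  proof -
    have "?out s = ?out s'" by (rule assg_stage_cong) (use that in auto)
    then show ?thesis by (simp only: Q_def)
  qed
  have "measure_pmf.prob (samples n ?I) {s. \<not> Q s}
    \<le> measure_pmf.prob (samples n ?I) {s. F (?out s) - min_value F > \<epsilon>\<^sub>0 / 2 ^ K + \<epsilon>}"
    using final_accuracy[OF \<epsilon>] unfolding K_def[symmetric]
    by (intro measure_pmf.finite_measure_mono) (auto simp: Q_def)
  also have "\<dots> \<le> \<delta>"
    using assg_failure_bound[OF ne lg \<epsilon>(1) c \<epsilon>0 w0 \<delta>' D1 t1 t, of K] K by (simp add: \<delta>'_def)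
  finally have "1 - \<delta> \<le> measure_pmf.prob (samples n ?I) {s. Q s}"
    using measure_pmf.prob_compl[of "{s. Q s}" "samples n ?I"]
    by (simp add: Collect_neg_eq Compl_eq_Diff_UNIV)
  also have "\<dots> \<le> measure M {\<omega> \<in> space M. Q (\<lambda>i. (\<lambda>(k, \<tau>). \<xi> k \<tau>) i \<omega>)}"
    by (rule prob_samples_le[OF M _ n indep distr Qcong]) simp
  finally show ?thesis
    by (simp add: Q_def assg_output_def K_def t_def D1_def)
qed

section \<open>Iteration complexity\<close>

text \<open>Since \<open>D\<^sub>1\<^sup>2 / \<epsilon>\<^sub>0\<^sup>2 = c\<^sup>2 / \<epsilon>\<close>, a stage has about \<open>(ln (1 / \<delta>) + ln K) / \<epsilon>\<close> iterates up to a constant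
  factor, and there are \<open>K = O(1 + ln (1 / \<epsilon>))\<close> stages. The crude bound \<open>ln K \<le> K\<close> gives the second
  logarithmic factor. The bound \<open>\<delta> \<le> \<delta>\<^sub>m < 1\<close> keeps \<open>ln (1 / \<delta>)\<close> away from 0, so that all additive
  constants can be absorbed into multiples of it; they are collected in \<open>a\<close> and \<open>b\<close>.\<close>

lemma assg_complexity_bound:
  assumes c: "c > 0" and G: "G > 0" and \<epsilon>0: "\<epsilon>\<^sub>0 > 0" and \<delta>m: "0 < \<delta>\<^sub>m" "\<delta>\<^sub>m < 1"
  shows "\<exists>C>0. \<forall>\<epsilon> \<delta>. 0 < \<epsilon> \<and> \<epsilon> < min 1 \<epsilon>\<^sub>0 \<and> 0 < \<delta> \<and> \<delta> \<le> \<delta>\<^sub>m \<longrightarrow>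
    real (assg_complexity (1/2) c G \<epsilon>\<^sub>0 \<epsilon> \<delta>) \<le> C * (1 + ln (1 / \<epsilon>))\<^sup>2 * (ln (1 / \<delta>) / \<epsilon>)"
proof -
  define l where "l = ln (1 / \<delta>\<^sub>m)"
  have l: "l > 0" using \<delta>m by (simp add: l_def)
  define a where "a = \<bar>log 2 \<epsilon>\<^sub>0\<bar> + 1 / ln 2 + 1"
  have a: "a > 0" by (simp add: a_def add_nonneg_pos)
  define b where "b = (9 / l + 1728 * a / l + 1728) * (G\<^sup>2 * c\<^sup>2) + 1 / l"
  have b: "b > 0" unfolding b_def using l a by (intro add_nonneg_pos) auto
  have "real (assg_complexity (1/2) c G \<epsilon>\<^sub>0 \<epsilon> \<delta>) \<le> a * b * (1 + ln (1 / \<epsilon>))\<^sup>2 * (ln (1 / \<delta>) / \<epsilon>)"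
    if \<epsilon>: "0 < \<epsilon>" "\<epsilon> < 1" "\<epsilon> < \<epsilon>\<^sub>0" and \<delta>: "0 < \<delta>" "\<delta> \<le> \<delta>\<^sub>m" for \<epsilon> \<delta>
  proof -
    define X where "X = 1 + ln (1 / \<epsilon>)"
    define L where "L = ln (1 / \<delta>)"
    define K where "K = assg_K \<epsilon>\<^sub>0 \<epsilon>"
    define t where "t = assg_t (1/2) c G \<epsilon>\<^sub>0 \<epsilon> \<delta>"
    have X: "X \<ge> 1" using \<epsilon> by (simp add: X_def)
    have L: "L \<ge> l" unfolding L_def l_def using \<delta> \<delta>m by (simp add: ln_div)
    have K1: "K \<ge> 1" unfolding K_def using assg_K_ge_1 \<epsilon> by blast
    have "log 2 (\<epsilon>\<^sub>0 / \<epsilon>) \<ge> 0" using \<epsilon> by simp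
    then have "real K \<le> log 2 (\<epsilon>\<^sub>0 / \<epsilon>) + 1"
      unfolding K_def assg_K_def by linarith
    also have "log 2 (\<epsilon>\<^sub>0 / \<epsilon>) = log 2 \<epsilon>\<^sub>0 + ln (1 / \<epsilon>) / ln 2"
      using \<epsilon> \<epsilon>0 by (simp add: log_def ln_div field_simps)
    also have "log 2 \<epsilon>\<^sub>0 + ln (1 / \<epsilon>) / ln 2 + 1 \<le> \<bar>log 2 \<epsilon>\<^sub>0\<bar> * X + X / ln 2 + X"
    proof (intro add_mono)
      have "\<bar>log 2 \<epsilon>\<^sub>0\<bar> * 1 \<le> \<bar>log 2 \<epsilon>\<^sub>0\<bar> * X" using X by (intro mult_left_mono) auto
      then show "log 2 \<epsilon>\<^sub>0 \<le> \<bar>log 2 \<epsilon>\<^sub>0\<bar> * X" by simp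
      show "ln (1 / \<epsilon>) / ln 2 \<le> X / ln 2" by (intro divide_right_mono) (auto simp: X_def)
    qed (use X in auto)
    also have "\<dots> = a * X" by (simp add: a_def algebra_simps)
    finally have K: "real K \<le> a * X" .
    have "L / l \<ge> 1" using L l by simp
    have XL: "1 \<le> X * (L / l)" using mult_mono[OF X \<open>L / l \<ge> 1\<close>] X by simp
    have Lpos: "L > 0" using L l by simp
    have lnK: "ln (1 / (\<delta> / real K)) \<le> a * X + L"
    proof -
      have "ln (1 / (\<delta> / real K)) = ln (real K) + L"
        using \<delta> K1 by (simp add: L_def ln_div)
      moreover have "ln (real K) \<le> real K" using ln_le_minus_one[of "real K"] K1 by simp
      ultimately show ?thesis using K by linarith
    qed
    have aXL: "a * X \<le> a / l * (X * L)"
    proof -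
      have "a * X * 1 \<le> a * X * (L / l)" using \<open>L / l \<ge> 1\<close> a X by (intro mult_left_mono) auto
      then show ?thesis by simp
    qed
    have LX: "L \<le> X * L" using X Lpos by simp
    have "max 9 (1728 * ln (1 / (\<delta> / real K))) \<le> 9 + 1728 * (a * X + L)"
      using lnK a X Lpos by (simp add: max_def)
    also have "\<dots> \<le> 9 / l * (X * L) + 1728 * (a / l * (X * L) + X * L)"
      using XL aXL LX by (intro add_mono mult_left_mono) auto
    also have "\<dots> = (9 / l + 1728 * a / l + 1728) * (X * L)" by (simp add: algebra_simps)
    finally have mx: "max 9 (1728 * ln (1 / (\<delta> / real K))) \<le> (9 / l + 1728 * a / l + 1728) * (X * L)" .
    have DE: "(assg_D1 (1/2) c \<epsilon>\<^sub>0 \<epsilon>)\<^sup>2 / \<epsilon>\<^sub>0\<^sup>2 = c\<^sup>2 / \<epsilon>"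
      using \<epsilon> \<epsilon>0 by (simp add: assg_D1_half power_divide power_mult_distrib)
    define m where "m = max 9 (1728 * ln (1 / (\<delta> / real K))) * G\<^sup>2 * (assg_D1 (1/2) c \<epsilon>\<^sub>0 \<epsilon>)\<^sup>2 / \<epsilon>\<^sub>0\<^sup>2"
    have m: "m = max 9 (1728 * ln (1 / (\<delta> / real K))) * (G\<^sup>2 * c\<^sup>2) / \<epsilon>"
    proof -
      have "m = max 9 (1728 * ln (1 / (\<delta> / real K))) * G\<^sup>2 * ((assg_D1 (1/2) c \<epsilon>\<^sub>0 \<epsilon>)\<^sup>2 / \<epsilon>\<^sub>0\<^sup>2)"
        by (simp add: m_def)
      then show ?thesis unfolding DE by simp
    qed
    have "m \<ge> 0" unfolding m using \<epsilon> by (simp add: le_max_iff_disj)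
    then have "real t \<le> m + 1" unfolding t_def assg_t_def K_def[symmetric] m_def[symmetric] by linarith
    also have "\<dots> \<le> (9 / l + 1728 * a / l + 1728) * (X * L) * (G\<^sup>2 * c\<^sup>2) / \<epsilon> + 1 / l * (X * L) / \<epsilon>"
    proof (rule add_mono)
      show "m \<le> (9 / l + 1728 * a / l + 1728) * (X * L) * (G\<^sup>2 * c\<^sup>2) / \<epsilon>"
        unfolding m using mx \<epsilon> by (intro divide_right_mono mult_right_mono) auto
      have "1 \<le> 1 / l * (X * L)" using XL by simp
      also have "\<dots> \<le> 1 / l * (X * L) / \<epsilon>"
        using \<epsilon> l X Lpos by (simp add: pos_le_divide_eq mult_left_le)
      finally show "1 \<le> 1 / l * (X * L) / \<epsilon>" .
    qed
    also have "\<dots> = b * (X * L / \<epsilon>)" by (simp add: b_def add_divide_distrib algebra_simps)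
    finally have t: "real t \<le> b * (X * L / \<epsilon>)" .
    have "real (assg_complexity (1/2) c G \<epsilon>\<^sub>0 \<epsilon> \<delta>) = real K * real t"
      by (simp add: assg_complexity_def K_def t_def)
    also have "\<dots> \<le> (a * X) * (b * (X * L / \<epsilon>))"
      using K t a X by (intro mult_mono) auto
    also have "\<dots> = a * b * X\<^sup>2 * (L / \<epsilon>)" by (simp add: power2_eq_square)
    finally show ?thesis by (simp add: X_def L_def)
  qed
  with a b show ?thesis by (intro exI[of _ "a * b"]) auto
qed

section \<open>Growth, accuracy and complexity for the regularized risk\<close>

theorem corollary18:
  fixes x :: "nat \<Rightarrow> real ^ 'd" and y :: "nat \<Rightarrow> 'y" and loss :: "real \<Rightarrow> 'y \<Rightarrow> real"
    and R F :: "real ^ 'd \<Rightarrow> real" and f :: "nat \<Rightarrow> real ^ 'd \<Rightarrow> real" and \<mu> :: real and n :: nat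
  assumes n: "n \<ge> 1" and mu: "\<mu> > 0"
    and loss_convex: "\<And>i. i \<in> {1..n} \<Longrightarrow> convex_on UNIV (\<lambda>z. loss z (y i))"
    and loss_pcq: "\<And>i. i \<in> {1..n} \<Longrightarrow> piecewise_convex_quadratic (\<lambda>z. loss z (y i))"
    and R: "admissible_regularizer R"
    and F: "F = regularized_risk loss x y \<mu> R n"
    and f: "f = regularized_loss loss x y \<mu> R"
    and minimizers_nonempty: "minimizers F \<noteq> {}"
  shows "(\<forall>\<epsilon>>0. \<exists>c>0. local_growth F (1/2) c \<epsilon>) \<and>
    (\<forall>(M :: 'p measure) \<xi> g G c \<epsilon>\<^sub>0 \<epsilon> \<delta> w\<^sub>0.
       G > 0 \<and> c > 0 \<and> 0 < \<epsilon> \<and> \<epsilon> < min 1 \<epsilon>\<^sub>0 \<and> 0 < \<delta> \<and> \<delta> < 1 \<and>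
       local_growth F (1/2) c \<epsilon> \<and>
       F w\<^sub>0 - min_value F \<le> \<epsilon>\<^sub>0 \<and>
       (\<forall>i\<in>{1..n}. \<forall>w. is_subgradient (f i) w (g i w) \<and> norm (g i w) \<le> G) \<and>
       iid_uniform_samples M n \<xi> ({1..assg_K \<epsilon>\<^sub>0 \<epsilon>} \<times> {1..<assg_t (1/2) c G \<epsilon>\<^sub>0 \<epsilon> \<delta>})
       \<longrightarrow> measure M {\<omega> \<in> space M.
              F (assg_output g (1/2) c G \<epsilon>\<^sub>0 \<epsilon> \<delta> (\<lambda>k \<tau>. \<xi> k \<tau> \<omega>) w\<^sub>0) - min_value F \<le> 2 * \<epsilon>}
            \<ge> 1 - \<delta>) \<and>
    (\<forall>c>0. \<forall>G>0. \<forall>\<epsilon>\<^sub>0>0. \<forall>\<delta>\<^sub>m\<in>{0<..<1}. \<exists>C>0. \<exists>p :: nat. \<forall>\<epsilon> \<delta>.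
       0 < \<epsilon> \<and> \<epsilon> < min 1 \<epsilon>\<^sub>0 \<and> 0 < \<delta> \<and> \<delta> \<le> \<delta>\<^sub>m
       \<longrightarrow> real (assg_complexity (1/2) c G \<epsilon>\<^sub>0 \<epsilon> \<delta>) \<le> C * (1 + ln (1 / \<epsilon>)) ^ p * (ln (1 / \<delta>) / \<epsilon>))"
proof (intro conjI)
  show "\<forall>\<epsilon>>0. \<exists>c>0. local_growth F (1/2) c \<epsilon>"
  proof (intro allI impI)
    fix \<epsilon> :: real assume "\<epsilon> > 0"
    then show "\<exists>c>0. local_growth F (1/2) c \<epsilon>"
      using minimizers_nonempty regularized_risk_properties[where loss = loss and y = y and n = n and x = x,
          OF mu loss_convex loss_pcq R]
      unfolding F by (intro local_growth_pieces_convex_quadratic)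
  qed
next
  have F_eq: "F w = (1 / real n) * (\<Sum>i=1..n. f i w)" for w
    using n by (simp add: F f regularized_risk_def regularized_loss_def sum.distrib distrib_left)
  show "\<forall>(M :: 'p measure) \<xi> g G c \<epsilon>\<^sub>0 \<epsilon> \<delta> w\<^sub>0.
       G > 0 \<and> c > 0 \<and> 0 < \<epsilon> \<and> \<epsilon> < min 1 \<epsilon>\<^sub>0 \<and> 0 < \<delta> \<and> \<delta> < 1 \<and>
       local_growth F (1/2) c \<epsilon> \<and>
       F w\<^sub>0 - min_value F \<le> \<epsilon>\<^sub>0 \<and>
       (\<forall>i\<in>{1..n}. \<forall>w. is_subgradient (f i) w (g i w) \<and> norm (g i w) \<le> G) \<and>
       iid_uniform_samples M n \<xi> ({1..assg_K \<epsilon>\<^sub>0 \<epsilon>} \<times> {1..<assg_t (1/2) c G \<epsilon>\<^sub>0 \<epsilon> \<delta>})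
       \<longrightarrow> measure M {\<omega> \<in> space M.
              F (assg_output g (1/2) c G \<epsilon>\<^sub>0 \<epsilon> \<delta> (\<lambda>k \<tau>. \<xi> k \<tau> \<omega>) w\<^sub>0) - min_value F \<le> 2 * \<epsilon>}
            \<ge> 1 - \<delta>"
  proof (intro allI impI, elim conjE)
    fix M :: "'p measure" and \<xi> g G c \<epsilon>\<^sub>0 \<epsilon> \<delta> w\<^sub>0
    assume *: "(0::real) < G" "(0::real) < c" "(0::real) < \<epsilon>" "\<epsilon> < min 1 \<epsilon>\<^sub>0" "(0::real) < \<delta>" "\<delta> < 1"
      "local_growth F (1/2) c \<epsilon>" "F w\<^sub>0 - min_value F \<le> \<epsilon>\<^sub>0"
      "\<forall>i\<in>{1..n}. \<forall>w. is_subgradient (f i) w (g i w) \<and> norm (g i w) \<le> G"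
      "iid_uniform_samples M n \<xi> ({1..assg_K \<epsilon>\<^sub>0 \<epsilon>} \<times> {1..<assg_t (1/2) c G \<epsilon>\<^sub>0 \<epsilon> \<delta>})"
    interpret bounded_subgradient_average F f g n G
      by unfold_locales (use * n F_eq in auto)
    show "1 - \<delta> \<le> measure M {\<omega> \<in> space M.
        F (assg_output g (1/2) c G \<epsilon>\<^sub>0 \<epsilon> \<delta> (\<lambda>k \<tau>. \<xi> k \<tau> \<omega>) w\<^sub>0) - min_value F \<le> 2 * \<epsilon>}"
      by (rule assg_high_probability[OF minimizers_nonempty *(7) *(2) *(3) _ *(5) *(6) *(8) *(10)])
        (use *(4) in simp)
  qed
next
  show "\<forall>c>0. \<forall>G>0. \<forall>\<epsilon>\<^sub>0>0. \<forall>\<delta>\<^sub>m\<in>{0<..<1}. \<exists>C>0. \<exists>p :: nat. \<forall>\<epsilon> \<delta>.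
       0 < \<epsilon> \<and> \<epsilon> < min 1 \<epsilon>\<^sub>0 \<and> 0 < \<delta> \<and> \<delta> \<le> \<delta>\<^sub>m
       \<longrightarrow> real (assg_complexity (1/2) c G \<epsilon>\<^sub>0 \<epsilon> \<delta>) \<le> C * (1 + ln (1 / \<epsilon>)) ^ p * (ln (1 / \<delta>) / \<epsilon>)"
  proof (intro allI impI ballI)
    fix c G \<epsilon>\<^sub>0 \<delta>\<^sub>m :: real
    assume "c > 0" "G > 0" "\<epsilon>\<^sub>0 > 0" "\<delta>\<^sub>m \<in> {0<..<1}"
    then show "\<exists>C>0. \<exists>p :: nat. \<forall>\<epsilon> \<delta>.
       0 < \<epsilon> \<and> \<epsilon> < min 1 \<epsilon>\<^sub>0 \<and> 0 < \<delta> \<and> \<delta> \<le> \<delta>\<^sub>m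
       \<longrightarrow> real (assg_complexity (1/2) c G \<epsilon>\<^sub>0 \<epsilon> \<delta>) \<le> C * (1 + ln (1 / \<epsilon>)) ^ p * (ln (1 / \<delta>) / \<epsilon>)"
      using assg_complexity_bound[of c G \<epsilon>\<^sub>0 \<delta>\<^sub>m] by auto
  qed
qed

end
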